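(* Let $\Sigma$ be a signature. The categories $\mathbf{MAlg}(\Sigma)$ of $\Sigma$-multialgebras and $\mathbf{Alg}_{\mathsf{B}}(\Sigma)$ of $(\Sigma,\leq)$-algebras are equivalent, an equivalence being given by the functors $\mathbb{P}:\mathbf{MAlg}(\Sigma)\to\mathbf{Alg}_{\mathsf{B}}(\Sigma)$ and $\mathbb{A}:\mathbf{Alg}_{\mathsf{B}}(\Sigma)\to\mathbf{MAlg}(\Sigma)$ (that is, $\mathbb{A}\circ\mathbb{P}$ and $\mathbb{P}\circ\mathbb{A}$ are naturally isomorphic to the respective identity functors).
   Context: A signature is a family $\Sigma=\{\Sigma_n\}_{n\in\mathbb{N}}$ of pairwise disjoint, possibly empty sets; elements of $\Sigma_n$ are $n$-ary symbols, and $\Sigma$ also denotes the union of the $\Sigma_n$. Write $\mathcal{P}^*(A)=\mathcal{P}(A)\setminus\{\emptyset\}$. A $\Sigma$-multialgebra is a pair $\mathcal{A}=(A,\{\sigma_{\mathcal{A}}\}_{\sigma\in\Sigma})$ with $A$ a non-empty set and $\sigma_{\mathcal{A}}:A^n\to\mathcal{P}^*(A)$ for $\sigma\in\Sigma_n$. A homomorphism $h:\mathcal{A}\to\mathcal{B}$ of $\Sigma$-multialgebras is a function $h:A\to B$ with $\{h(a):a\in\sigma_{\mathcal{A}}(a_1,\ldots,a_n)\}\subseteq\sigma_{\mathcal{B}}(h(a_1),\ldots,h(a_n))$ for all $n$, $\sigma\in\Sigma_n$, $a_1,\ldots,a_n\in A$. $\mathbf{MAlg}(\Sigma)$ is the category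 of $\Sigma$-multialgebras and these homomorphisms. For a non-empty poset $(A,\leq)$, let $(A,\leq)_0$ be the poset on $A\cup\{0\}$ (with $0\notin A$) obtained by adjoining $0$ as a new least element. $(A,\leq)$ is a complete, atomic and bottomless Boolean algebra if $(A,\leq)_0$ is a complete, atomic Boolean algebra (with $0\neq 1$), where atomic means every element is the supremum of the atoms below it. The atoms of $(A,\leq)$ are its minimal elements, and $A_a$ denotes the set of atoms less than or equal to $a$. A $(\Sigma,\leq)$-algebra is a triple $\mathcal{A}=(A,\{\sigma_{\mathcal{A}}\}_{\sigma\in\Sigma},\leq_{\mathcal{A}})$ such that $(A,\{\sigma_{\mathcal{A}}\})$ is a $\Sigma$-algebra (each $\sigma\in\Sigma_n$ is interpreted by a function $A^n\to A$), $(A,\leq_{\mathcal{A}})$ is a complete, atomic and bottomless Boolean algebra, and $\sigma_{\mathcal{A}}(a_1,\ldots,a_n)=\sup\{\sigma_{\mathcal{A}}(b_1,\ldots,b_n):(b_1,\ldots,b_n)\in A_{a_1}\times\cdots\times A_{a_n}\}$ for all $\sigma\in\Sigma_n$, $a_1,\ldots,a_n\in A$. A $(\Sigma,\leq)$-homomorphism $h:\mathcal{A}\to\mathcal{B}$ is a function $h:A\to B$ such that (1) $h(\sigma_{\mathcal{A}}(a_1,\ldots,a_n))\leq_{\mathcal{B}}\sigma_{\mathcal{B}}(h(a_1),\ldots,h(a_n))$ for all $\sigma\in\Sigma_n$ and $a_i\in A$; (2) $h(\sup A')=\sup\{h(a):a\in A'\}$ for every non-empty $A'\subseteq A$; (3)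 $h$ maps minimal elements to minimal elements. $\mathbf{Alg}_{\mathsf{B}}(\Sigma)$ is the category of $(\Sigma,\leq)$-algebras and $(\Sigma,\leq)$-homomorphisms. The functor $\mathbb{P}$: $\mathbb{P}(\mathcal{A})$ has universe $\mathcal{P}^*(A)$, order given by inclusion, and operations $\sigma_{\mathbb{P}(\mathcal{A})}(A_1,\ldots,A_n)=\bigcup\{\sigma_{\mathcal{A}}(a_1,\ldots,a_n):a_i\in A_i\}$; for a homomorphism $h:\mathcal{A}\to\mathcal{B}$, $\mathbb{P}(h)(A')=\{h(a):a\in A'\}$. The functor $\mathbb{A}$: $\mathbb{A}(\mathcal{A})$ has as universe the set of atoms of $(A,\leq_{\mathcal{A}})$ and multioperations $\sigma_{\mathbb{A}(\mathcal{A})}(a_1,\ldots,a_n)=A_{\sigma_{\mathcal{A}}(a_1,\ldots,a_n)}$ for atoms $a_1,\ldots,a_n$; for a $(\Sigma,\leq)$-homomorphism $h$, $\mathbb{A}(h)$ is the restriction of $h$ to atoms. *)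

theory Defs
  imports
    "HOL-Algebra.Complete_Lattice"
    "HOL-Library.FuncSet"
    "HOL-Library.Disjoint_Sets"
    "HOL-Library.Equipollence"
begin

section \<open>Categories, functors, equivalences\<close>

text \<open>Arrows do not record their source and target: arrows with different sources or targets may
  be represented by the same value, so identities, composition and the arrow part of a functor take
  the objects involved as arguments.\<close>

record ('o, 'm) cat =
  Obj :: "'o set"
  Hom :: "'o \<Rightarrow> 'o \<Rightarrow> 'm set"
  Ident :: "'o \<Rightarrow> 'm"
  Comp :: "'o \<Rightarrow> 'o \<Rightarrow> 'o \<Rightarrow> 'm \<Rightarrow> 'm \<Rightarrow> 'm"

definition category :: "('o, 'm) cat \<Rightarrow> bool" where
  "category C \<longleftrightarrow>
     (\<forall>X\<in>Obj C. Ident C X \<in> Hom C X X) \<and>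
     (\<forall>X\<in>Obj C. \<forall>Y\<in>Obj C. \<forall>Z\<in>Obj C. \<forall>f\<in>Hom C X Y. \<forall>g\<in>Hom C Y Z.
        Comp C X Y Z g f \<in> Hom C X Z) \<and>
     (\<forall>X\<in>Obj C. \<forall>Y\<in>Obj C. \<forall>f\<in>Hom C X Y.
        Comp C X X Y f (Ident C X) = f \<and> Comp C X Y Y (Ident C Y) f = f) \<and>
     (\<forall>W\<in>Obj C. \<forall>X\<in>Obj C. \<forall>Y\<in>Obj C. \<forall>Z\<in>Obj C.
        \<forall>f\<in>Hom C W X. \<forall>g\<in>Hom C X Y. \<forall>h\<in>Hom C Y Z.
          Comp C W X Z (Comp C X Y Z h g) f = Comp C W Y Z h (Comp C W X Y g f))"

definition iso_in :: "('o, 'm) cat \<Rightarrow> 'o \<Rightarrow> 'o \<Rightarrow> 'm \<Rightarrow> bool" where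
  "iso_in C X Y f \<longleftrightarrow> f \<in> Hom C X Y \<and>
     (\<exists>g\<in>Hom C Y X. Comp C X Y X g f = Ident C X \<and> Comp C Y X Y f g = Ident C Y)"

definition full_subcategory :: "('o, 'm) cat \<Rightarrow> 'o set \<Rightarrow> ('o, 'm) cat" where
  "full_subcategory C O' = C\<lparr>Obj := Obj C \<inter> O'\<rparr>"

record ('o1, 'm1, 'o2, 'm2) ftor =
  fobj :: "'o1 \<Rightarrow> 'o2"
  farr :: "'o1 \<Rightarrow> 'o1 \<Rightarrow> 'm1 \<Rightarrow> 'm2"

definition is_functor :: "('o1, 'm1) cat \<Rightarrow> ('o2, 'm2) cat \<Rightarrow> ('o1, 'm1, 'o2, 'm2) ftor \<Rightarrow> bool" where
  "is_functor C D F \<longleftrightarrow> category C \<and> category D \<and>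
     (\<forall>X\<in>Obj C. fobj F X \<in> Obj D) \<and>
     (\<forall>X\<in>Obj C. \<forall>Y\<in>Obj C. \<forall>f\<in>Hom C X Y. farr F X Y f \<in> Hom D (fobj F X) (fobj F Y)) \<and>
     (\<forall>X\<in>Obj C. farr F X X (Ident C X) = Ident D (fobj F X)) \<and>
     (\<forall>X\<in>Obj C. \<forall>Y\<in>Obj C. \<forall>Z\<in>Obj C. \<forall>f\<in>Hom C X Y. \<forall>g\<in>Hom C Y Z.
        farr F X Z (Comp C X Y Z g f) =
        Comp D (fobj F X) (fobj F Y) (fobj F Z) (farr F Y Z g) (farr F X Y f))"

definition id_ftor :: "('o, 'm, 'o, 'm) ftor" where
  "id_ftor = \<lparr>fobj = (\<lambda>X. X), farr = (\<lambda>_ _ f. f)\<rparr>"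

definition comp_ftor ::
  "('o2, 'm2, 'o3, 'm3) ftor \<Rightarrow> ('o1, 'm1, 'o2, 'm2) ftor \<Rightarrow> ('o1, 'm1, 'o3, 'm3) ftor"
  (infixl \<open>\<circ>\<^sub>F\<close> 55) where
  "G \<circ>\<^sub>F F = \<lparr>fobj = (\<lambda>X. fobj G (fobj F X)),
             farr = (\<lambda>X Y f. farr G (fobj F X) (fobj F Y) (farr F X Y f))\<rparr>"

definition naturally_isomorphic ::
  "('o1, 'm1) cat \<Rightarrow> ('o2, 'm2) cat \<Rightarrow> ('o1, 'm1, 'o2, 'm2) ftor \<Rightarrow> ('o1, 'm1, 'o2, 'm2) ftor \<Rightarrow> bool"
  where
  "naturally_isomorphic C D F G \<longleftrightarrow> is_functor C D F \<and> is_functor C D G \<and>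
     (\<exists>\<eta>. (\<forall>X\<in>Obj C. iso_in D (fobj F X) (fobj G X) (\<eta> X)) \<and>
          (\<forall>X\<in>Obj C. \<forall>Y\<in>Obj C. \<forall>f\<in>Hom C X Y.
             Comp D (fobj F X) (fobj F Y) (fobj G Y) (\<eta> Y) (farr F X Y f) =
             Comp D (fobj F X) (fobj G X) (fobj G Y) (farr G X Y f) (\<eta> X)))"

definition equivalence_of_categories ::
  "('o1, 'm1) cat \<Rightarrow> ('o2, 'm2) cat \<Rightarrow> ('o1, 'm1, 'o2, 'm2) ftor \<Rightarrow> ('o2, 'm2, 'o1, 'm1) ftor \<Rightarrow> bool"
  where
  "equivalence_of_categories C D F G \<longleftrightarrow> is_functor C D F \<and> is_functor D C G \<and>
     naturally_isomorphic C C id_ftor (G \<circ>\<^sub>F F) \<and> naturally_isomorphic D D id_ftor (F \<circ>\<^sub>F G)"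

section \<open>Signatures and multialgebras\<close>

definition signature :: "(nat \<Rightarrow> 's set) \<Rightarrow> bool" where
  "signature S \<longleftrightarrow> disjoint_family S"

text \<open>An \<open>n\<close>-tuple is a list of length \<open>n\<close>, and the operations of an algebra are bundled into a
  single function on pairs (symbol, argument tuple). Operations and morphisms are extensional
  functions, so that equality of objects and of morphisms is the set-theoretic one.\<close>

definition op_dom :: "(nat \<Rightarrow> 's set) \<Rightarrow> 'a set \<Rightarrow> ('s \<times> 'a list) set" where
  "op_dom S A = {(\<sigma>, xs). \<sigma> \<in> S (length xs) \<and> set xs \<subseteq> A}"

definition Pow_ne :: "'a set \<Rightarrow> 'a set set" where
  "Pow_ne A = Pow A - {{}}"

record ('s, 'a) malg =
  mcarr :: "'a set"
  mop :: "'s \<times> 'a list \<Rightarrow> 'a set"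

definition multialgebra :: "(nat \<Rightarrow> 's set) \<Rightarrow> ('s, 'a) malg \<Rightarrow> bool" where
  "multialgebra S M \<longleftrightarrow> mcarr M \<noteq> {} \<and> mop M \<in> op_dom S (mcarr M) \<rightarrow>\<^sub>E Pow_ne (mcarr M)"

definition malg_hom :: "(nat \<Rightarrow> 's set) \<Rightarrow> ('s, 'a) malg \<Rightarrow> ('s, 'b) malg \<Rightarrow> ('a \<Rightarrow> 'b) set" where
  "malg_hom S M N = {h \<in> mcarr M \<rightarrow>\<^sub>E mcarr N.
     \<forall>(\<sigma>, xs)\<in>op_dom S (mcarr M). h ` mop M (\<sigma>, xs) \<subseteq> mop N (\<sigma>, map h xs)}"

definition MAlg :: "(nat \<Rightarrow> 's set) \<Rightarrow> (('s, 'a) malg, 'a \<Rightarrow> 'a) cat" where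
  "MAlg S = \<lparr>Obj = {M. multialgebra S M}, Hom = malg_hom S,
             Ident = (\<lambda>M. \<lambda>x\<in>mcarr M. x), Comp = (\<lambda>M _ _ g f. compose (mcarr M) g f)\<rparr>"

section \<open>Complete, atomic and bottomless Boolean algebras\<close>

definition lattice_atoms :: "('a, 'b) gorder_scheme \<Rightarrow> 'a set" where
  "lattice_atoms L = {a \<in> carrier L. a \<noteq> \<bottom>\<^bsub>L\<^esub> \<and> (\<forall>x\<in>carrier L. x \<sqsubseteq>\<^bsub>L\<^esub> a \<longrightarrow> x = \<bottom>\<^bsub>L\<^esub> \<or> x = a)}"

definition complete_atomic_boolean_algebra :: "('a, 'b) gorder_scheme \<Rightarrow> bool" where
  "complete_atomic_boolean_algebra L \<longleftrightarrow> complete_lattice L \<and>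
     (\<forall>x\<in>carrier L. \<forall>y\<in>carrier L. \<forall>z\<in>carrier L.
        x \<sqinter>\<^bsub>L\<^esub> (y \<squnion>\<^bsub>L\<^esub> z) = (x \<sqinter>\<^bsub>L\<^esub> y) \<squnion>\<^bsub>L\<^esub> (x \<sqinter>\<^bsub>L\<^esub> z)) \<and>
     (\<forall>x\<in>carrier L. \<exists>y\<in>carrier L. x \<sqinter>\<^bsub>L\<^esub> y = \<bottom>\<^bsub>L\<^esub> \<and> x \<squnion>\<^bsub>L\<^esub> y = \<top>\<^bsub>L\<^esub>) \<and>
     \<bottom>\<^bsub>L\<^esub> \<noteq> \<top>\<^bsub>L\<^esub> \<and>
     (\<forall>x\<in>carrier L. x = \<Squnion>\<^bsub>L\<^esub>{a \<in> lattice_atoms L. a \<sqsubseteq>\<^bsub>L\<^esub> x})"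

definition adjoin_bottom :: "'a gorder \<Rightarrow> 'a option gorder" where
  "adjoin_bottom L = \<lparr>carrier = insert None (Some ` carrier L), eq = (=),
     le = (\<lambda>x y. case x of None \<Rightarrow> True
                 | Some a \<Rightarrow> (case y of None \<Rightarrow> False | Some b \<Rightarrow> a \<sqsubseteq>\<^bsub>L\<^esub> b))\<rparr>"

definition bottomless_boolean_algebra :: "'a gorder \<Rightarrow> bool" where
  "bottomless_boolean_algebra L \<longleftrightarrow> partial_order L \<and> carrier L \<noteq> {} \<and>
     complete_atomic_boolean_algebra (adjoin_bottom L)"

definition minimals :: "('a, 'b) gorder_scheme \<Rightarrow> 'a set" where
  "minimals L = {a \<in> carrier L. \<forall>x\<in>carrier L. x \<sqsubseteq>\<^bsub>L\<^esub> a \<longrightarrow> x = a}"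

definition atoms_below :: "('a, 'b) gorder_scheme \<Rightarrow> 'a \<Rightarrow> 'a set" where
  "atoms_below L a = {x \<in> minimals L. x \<sqsubseteq>\<^bsub>L\<^esub> a}"

section \<open>Ordered algebras over a signature\<close>

record ('s, 'a) balg =
  bcarr :: "'a set"
  bop :: "'s \<times> 'a list \<Rightarrow> 'a"
  ble :: "'a rel"

definition ord_of :: "('s, 'a) balg \<Rightarrow> 'a gorder" where
  "ord_of B = \<lparr>carrier = bcarr B, eq = (=), le = (\<lambda>x y. (x, y) \<in> ble B)\<rparr>"

definition ordered_algebra :: "(nat \<Rightarrow> 's set) \<Rightarrow> ('s, 'a) balg \<Rightarrow> bool" where
  "ordered_algebra S B \<longleftrightarrow>
     bop B \<in> op_dom S (bcarr B) \<rightarrow>\<^sub>E bcarr B \<and>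
     ble B \<subseteq> bcarr B \<times> bcarr B \<and> bottomless_boolean_algebra (ord_of B) \<and>
     (\<forall>(\<sigma>, xs)\<in>op_dom S (bcarr B).
        bop B (\<sigma>, xs) =
        \<Squnion>\<^bsub>ord_of B\<^esub>{bop B (\<sigma>, ys) | ys. ys \<in> listset (map (atoms_below (ord_of B)) xs)})"

definition balg_hom :: "(nat \<Rightarrow> 's set) \<Rightarrow> ('s, 'a) balg \<Rightarrow> ('s, 'b) balg \<Rightarrow> ('a \<Rightarrow> 'b) set" where
  "balg_hom S A B = {h \<in> bcarr A \<rightarrow>\<^sub>E bcarr B.
     (\<forall>(\<sigma>, xs)\<in>op_dom S (bcarr A). h (bop A (\<sigma>, xs)) \<sqsubseteq>\<^bsub>ord_of B\<^esub> bop B (\<sigma>, map h xs)) \<and>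
     (\<forall>X. X \<subseteq> bcarr A \<and> X \<noteq> {} \<longrightarrow> h (\<Squnion>\<^bsub>ord_of A\<^esub>X) = \<Squnion>\<^bsub>ord_of B\<^esub>(h ` X)) \<and>
     h ` minimals (ord_of A) \<subseteq> minimals (ord_of B)}"

definition AlgB :: "(nat \<Rightarrow> 's set) \<Rightarrow> (('s, 'a) balg, 'a \<Rightarrow> 'a) cat" where
  "AlgB S = \<lparr>Obj = {B. ordered_algebra S B}, Hom = balg_hom S,
             Ident = (\<lambda>B. \<lambda>x\<in>bcarr B. x), Comp = (\<lambda>B _ _ g f. compose (bcarr B) g f)\<rparr>"

section \<open>The functors \<open>\<P>\<close> and \<open>\<A>\<close>\<close>

definition P_alg :: "(nat \<Rightarrow> 's set) \<Rightarrow> ('s, 'a) malg \<Rightarrow> ('s, 'a set) balg" where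
  "P_alg S M = \<lparr>bcarr = Pow_ne (mcarr M),
     bop = (\<lambda>(\<sigma>, Xs)\<in>op_dom S (Pow_ne (mcarr M)). \<Union>{mop M (\<sigma>, xs) | xs. xs \<in> listset Xs}),
     ble = {(X, Y). X \<in> Pow_ne (mcarr M) \<and> Y \<in> Pow_ne (mcarr M) \<and> X \<subseteq> Y}\<rparr>"

definition P_ftor ::
  "(nat \<Rightarrow> 's set) \<Rightarrow> (('s, 'a) malg, 'a \<Rightarrow> 'a, ('s, 'a set) balg, 'a set \<Rightarrow> 'a set) ftor" where
  "P_ftor S = \<lparr>fobj = P_alg S, farr = (\<lambda>M _ h. \<lambda>X\<in>Pow_ne (mcarr M). h ` X)\<rparr>"

definition A_malg :: "(nat \<Rightarrow> 's set) \<Rightarrow> ('s, 'a) balg \<Rightarrow> ('s, 'a) malg" where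
  "A_malg S B = \<lparr>mcarr = minimals (ord_of B),
     mop = (\<lambda>(\<sigma>, xs)\<in>op_dom S (minimals (ord_of B)). atoms_below (ord_of B) (bop B (\<sigma>, xs)))\<rparr>"

definition A_ftor ::
  "(nat \<Rightarrow> 's set) \<Rightarrow> (('s, 'a) balg, 'a \<Rightarrow> 'a, ('s, 'a) malg, 'a \<Rightarrow> 'a) ftor" where
  "A_ftor S = \<lparr>fobj = A_malg S, farr = (\<lambda>B _ h. restrict h (minimals (ord_of B)))\<rparr>"

section \<open>Natural isomorphism with the identity across types\<close>

text \<open>\<open>P_ftor\<close> leads from structures on subsets of \<open>'a\<close> to structures on subsets of \<open>'a set\<close>, so
  its composites with \<open>A_ftor\<close> change the type. Homomorphisms are polymorphic
  in both carrier types, and natural isomorphism with the identity is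
  \<open>naturally_isomorphic\<close> with such heterogeneous homomorphisms as components.\<close>

definition malg_iso :: "(nat \<Rightarrow> 's set) \<Rightarrow> ('s, 'a) malg \<Rightarrow> ('s, 'b) malg \<Rightarrow> ('a \<Rightarrow> 'b) \<Rightarrow> bool" where
  "malg_iso S M N f \<longleftrightarrow> f \<in> malg_hom S M N \<and>
     (\<exists>g\<in>malg_hom S N M. compose (mcarr M) g f = (\<lambda>x\<in>mcarr M. x) \<and>
                          compose (mcarr N) f g = (\<lambda>x\<in>mcarr N. x))"

definition balg_iso :: "(nat \<Rightarrow> 's set) \<Rightarrow> ('s, 'a) balg \<Rightarrow> ('s, 'b) balg \<Rightarrow> ('a \<Rightarrow> 'b) \<Rightarrow> bool" where
  "balg_iso S A B f \<longleftrightarrow> f \<in> balg_hom S A B \<and>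
     (\<exists>g\<in>balg_hom S B A. compose (bcarr A) g f = (\<lambda>x\<in>bcarr A. x) \<and>
                          compose (bcarr B) f g = (\<lambda>x\<in>bcarr B. x))"

definition malg_naturally_iso_to_id ::
  "(nat \<Rightarrow> 's set) \<Rightarrow> (('s, 'a) malg, 'a \<Rightarrow> 'a, ('s, 'b) malg, 'b \<Rightarrow> 'b) ftor \<Rightarrow> bool" where
  "malg_naturally_iso_to_id S F \<longleftrightarrow>
     (\<exists>\<eta>. (\<forall>M\<in>Obj (MAlg S). malg_iso S M (fobj F M) (\<eta> M)) \<and>
          (\<forall>M\<in>Obj (MAlg S). \<forall>N\<in>Obj (MAlg S). \<forall>h\<in>malg_hom S M N.
             compose (mcarr M) (\<eta> N) h = compose (mcarr M) (farr F M N h) (\<eta> M)))"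

definition balg_naturally_iso_to_id ::
  "(nat \<Rightarrow> 's set) \<Rightarrow> (('s, 'a) balg, 'a \<Rightarrow> 'a, ('s, 'b) balg, 'b \<Rightarrow> 'b) ftor \<Rightarrow> bool" where
  "balg_naturally_iso_to_id S F \<longleftrightarrow>
     (\<exists>\<eta>. (\<forall>A\<in>Obj (AlgB S). balg_iso S A (fobj F A) (\<eta> A)) \<and>
          (\<forall>A\<in>Obj (AlgB S). \<forall>B\<in>Obj (AlgB S). \<forall>h\<in>balg_hom S A B.
             compose (bcarr A) (\<eta> B) h = compose (bcarr A) (farr F A B h) (\<eta> A)))"

section \<open>Universes\<close>

text \<open>By Cantor's theorem no single type can hold \<open>\<P>*(A)\<close> for every set \<open>A\<close> of its elements. A
  universe is a type with a notion of small set, closed under passing to sets of no greater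
  cardinality, in which every small set is itself represented, via \<open>code\<close>, by an element. The
  set-theoretic universe, whose small subclasses are the sets and whose coding is the identity, has
  this form; within HOL,
  \<open>small_universe_exists\<close> gives, for every infinite type, a universe in which the sets of at most
  that cardinality are small.

  An ordered algebra is isomorphic to \<open>\<P>*\<close> of its set of atoms, so in a universe where small sets
  are closed under powersets its carrier is small iff its set of atoms is. In a universe lacking
  this closure the set of atoms is the one to be bounded.\<close>

definition small_universe :: "('u set \<Rightarrow> bool) \<Rightarrow> ('u set \<Rightarrow> 'u) \<Rightarrow> bool" where
  "small_universe small code \<longleftrightarrow>
     (\<forall>X Y. small X \<and> Y \<lesssim> X \<longrightarrow> small Y) \<and> inj_on code {X. small X}"

lemma small_universe_exists:
  assumes "infinite (UNIV :: 'a set)"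
  shows "\<exists>code. small_universe (\<lambda>X :: 'a set set. X \<lesssim> (UNIV :: 'a set)) code"
proof -
  obtain p :: "'a \<times> 'a \<Rightarrow> 'a" where p: "inj p"
    using card_of_Times_same_infinite[OF assms]
    unfolding card_of_ordIso[symmetric] bij_betw_def by auto
  obtain q :: "'a option \<Rightarrow> 'a" where q: "inj q"
  proof -
    have "(UNIV :: 'a option set) \<lesssim> (UNIV :: 'a set)"
    proof -
      have "(UNIV :: 'a option set) = insert None (range Some)" by (simp add: UNIV_option_conv)
      moreover have "range (Some :: 'a \<Rightarrow> 'a option) \<approx> (UNIV :: 'a set)"
        by (rule inj_on_image_eqpoll_self) simp
      moreover have "insert None (range (Some :: 'a \<Rightarrow> 'a option)) \<approx> range (Some :: 'a \<Rightarrow> 'a option)"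
        using assms by (intro infinite_insert_eqpoll) (simp add: finite_image_iff)
      ultimately show ?thesis using eqpoll_imp_lepoll eqpoll_trans by metis
    qed
    then show ?thesis using that unfolding lepoll_def by auto
  qed
  define e where "e X = (SOME f. inj_on f X \<and> f ` X \<subseteq> (UNIV :: 'a set))" for X :: "'a set set"
  have e: "inj_on (e X) X" if "X \<lesssim> (UNIV :: 'a set)" for X
    using someI_ex[OF that[unfolded lepoll_def]] by (simp add: e_def)
  define code where "code X = {p (e X x, q y) | x y. x \<in> X \<and> (y = None \<or> (\<exists>z\<in>x. y = Some z))}" for X
  have rec: "X = {x. \<exists>i. p (i, q None) \<in> code X \<and> x = {z. p (i, q (Some z)) \<in> code X}}"
    if "X \<lesssim> (UNIV :: 'a set)" for X
  proof -
    have 1: "p (i, q None) \<in> code X \<longleftrightarrow> (\<exists>x\<in>X. i = e X x)" for i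
      unfolding code_def using p q by (auto simp: inj_eq)
    have 2: "p (e X x, q (Some z)) \<in> code X \<longleftrightarrow> z \<in> x" if "x \<in> X" for x z
      unfolding code_def using p q e[OF \<open>X \<lesssim> UNIV\<close>] that by (auto simp: inj_eq inj_on_eq_iff)
    show ?thesis using 1 2 by auto
  qed
  have "inj_on code {X. X \<lesssim> (UNIV :: 'a set)}"
  proof (rule inj_onI)
    fix X Y :: "'a set set"
    assume X: "X \<in> {X. X \<lesssim> (UNIV :: 'a set)}" and Y: "Y \<in> {X. X \<lesssim> (UNIV :: 'a set)}"
      and eq: "code X = code Y"
    have "X = {x. \<exists>i. p (i, q None) \<in> code X \<and> x = {z. p (i, q (Some z)) \<in> code X}}"
      using X by (intro rec) simp
    also have "\<dots> = Y"
      unfolding eq using Y by (intro rec[symmetric]) simp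
    finally show "X = Y" .
  qed
  then show ?thesis unfolding small_universe_def by (blast intro: lepoll_trans)
qed

definition small_MAlg :: "('u set \<Rightarrow> bool) \<Rightarrow> (nat \<Rightarrow> 's set) \<Rightarrow> (('s, 'u) malg, 'u \<Rightarrow> 'u) cat" where
  "small_MAlg small S = full_subcategory (MAlg S) {M. small (mcarr M)}"

definition small_AlgB :: "('u set \<Rightarrow> bool) \<Rightarrow> (nat \<Rightarrow> 's set) \<Rightarrow> (('s, 'u) balg, 'u \<Rightarrow> 'u) cat" where
  "small_AlgB small S = full_subcategory (AlgB S) {B. small (minimals (ord_of B))}"

text \<open>Transport of structure along a map that is injective on the carriers concerned.\<close>

definition relabel_balg :: "('a \<Rightarrow> 'b) \<Rightarrow> (nat \<Rightarrow> 's set) \<Rightarrow> ('s, 'a) balg \<Rightarrow> ('s, 'b) balg" where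
  "relabel_balg c S B = \<lparr>bcarr = c ` bcarr B,
     bop = (\<lambda>(\<sigma>, ys)\<in>op_dom S (c ` bcarr B). c (bop B (\<sigma>, map (inv_into (bcarr B) c) ys))),
     ble = map_prod c c ` ble B\<rparr>"

definition relabel_ftor ::
  "('a \<Rightarrow> 'b) \<Rightarrow> (nat \<Rightarrow> 's set) \<Rightarrow> (('s, 'a) balg, 'a \<Rightarrow> 'a, ('s, 'b) balg, 'b \<Rightarrow> 'b) ftor" where
  "relabel_ftor c S = \<lparr>fobj = relabel_balg c S,
     farr = (\<lambda>A _ h. \<lambda>y\<in>c ` bcarr A. c (h (inv_into (bcarr A) c y)))\<rparr>"

definition coded_P_ftor ::
  "('u set \<Rightarrow> 'u) \<Rightarrow> (nat \<Rightarrow> 's set) \<Rightarrow> (('s, 'u) malg, 'u \<Rightarrow> 'u, ('s, 'u) balg, 'u \<Rightarrow> 'u) ftor" where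
  "coded_P_ftor code S = relabel_ftor code S \<circ>\<^sub>F P_ftor S"

end

theory Submission
  imports Defs
begin

text \<open>
  Call an ordered algebra represented by a multialgebra \<open>M\<close> if it is isomorphic to the algebra of
  non-empty subsets of \<open>M\<close>. Every ordered algebra is represented by the multialgebra of its
  atoms: sending an element to the set of atoms below it is an order isomorphism onto the non-empty
  sets of atoms, since by distributivity and complements the supremum of a set of atoms has no
  further atoms below it, and the operations are determined by their values on atoms. Let \<open>A\<close> be
  represented by \<open>M\<close> and \<open>B\<close> by \<open>N\<close>. A map \<open>A \<rightarrow> B\<close> that takes images under some \<open>k: M \<rightarrow> N\<close> is
  a homomorphism iff \<open>k\<close> is, and every homomorphism of ordered algebras takes images of sets of
  atoms. This makes both functors well defined, and it makes represented and representing algebras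
  unique up to the isomorphisms that form the two natural transformations. The subsets of \<open>M\<close> are
  labelled by an arbitrary injective \<open>c\<close>, of which the identity and the coding of a universe are
  instances.
\<close>

section \<open>Orders represented by families of sets\<close>

locale set_representation =
  fixes L :: "('a, 'b) gorder_scheme" (structure) and rep :: "'a \<Rightarrow> 'c set" and F :: "'c set set"
  assumes eq_is_equality: "(.=) = (=)"
    and bij: "bij_betw rep (carrier L) F"
    and le_iff_subset: "x \<in> carrier L \<Longrightarrow> y \<in> carrier L \<Longrightarrow> x \<sqsubseteq> y \<longleftrightarrow> rep x \<subseteq> rep y"
begin

lemma rep_closed: "x \<in> carrier L \<Longrightarrow> rep x \<in> F"
  using bij by (auto simp: bij_betw_def)

lemma rep_eq_iff: "x \<in> carrier L \<Longrightarrow> y \<in> carrier L \<Longrightarrow> rep x = rep y \<longleftrightarrow> x = y"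
  using bij by (auto simp: bij_betw_def inj_on_eq_iff)

lemma rep_cases:
  assumes "Y \<in> F"
  obtains x where "x \<in> carrier L" "rep x = Y"
  using assms bij by (auto simp: bij_betw_def)

sublocale partial_order L
  by unfold_locales (auto simp: eq_is_equality le_iff_subset rep_eq_iff[symmetric])

lemma least_Upper_if_rep_eq:
  assumes "A \<subseteq> carrier L" "x \<in> carrier L" "rep x = \<Union>(rep ` A)"
  shows "least L x (Upper L A)"
  by (rule least_UpperI) (use assms le_iff_subset in \<open>auto simp: Upper_def subset_iff\<close>)

lemma
  assumes A: "A \<subseteq> carrier L" "\<Union>(rep ` A) \<in> F"
  shows sup_in_carrier_if_Union: "\<Squnion>A \<in> carrier L"
    and rep_sup_if_Union: "rep (\<Squnion>A) = \<Union>(rep ` A)"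
proof -
  obtain x where x: "x \<in> carrier L" "rep x = \<Union>(rep ` A)"
    using rep_cases A(2) by metis
  have "\<Squnion>A = x"
    unfolding sup_def using least_Upper_if_rep_eq[OF A(1) x] least_unique by (intro some_equality)
  then show "\<Squnion>A \<in> carrier L" "rep (\<Squnion>A) = \<Union>(rep ` A)" using x by simp_all
qed

end

subsection \<open>Powersets\<close>

locale powerset_representation = set_representation L rep "Pow X"
  for L :: "('a, 'b) gorder_scheme" (structure) and rep :: "'a \<Rightarrow> 'c set" and X
begin

lemma greatest_Lower_if_rep_eq:
  assumes "A \<subseteq> carrier L" "x \<in> carrier L" "rep x = X \<inter> \<Inter>(rep ` A)"
  shows "greatest L x (Lower L A)"
  by (rule greatest_LowerI)
    (use assms le_iff_subset rep_closed in \<open>auto simp: Lower_def subset_iff Pow_def\<close>)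

sublocale complete_lattice L
proof
  fix A assume A: "A \<subseteq> carrier L"
  have "\<Union>(rep ` A) \<in> Pow X" using A rep_closed by blast
  then obtain s where "s \<in> carrier L" "rep s = \<Union>(rep ` A)" by (rule rep_cases)
  then show "\<exists>s. least L s (Upper L A)" using least_Upper_if_rep_eq[OF A] by blast
  have "X \<inter> \<Inter>(rep ` A) \<in> Pow X" by blast
  then obtain i where "i \<in> carrier L" "rep i = X \<inter> \<Inter>(rep ` A)" by (rule rep_cases)
  then show "\<exists>i. greatest L i (Lower L A)" using greatest_Lower_if_rep_eq[OF A] by blast
qed

lemma rep_Sup: "A \<subseteq> carrier L \<Longrightarrow> rep (\<Squnion>A) = \<Union>(rep ` A)"
  using rep_closed by (intro rep_sup_if_Union) auto

lemma rep_Inf: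
  assumes A: "A \<subseteq> carrier L"
  shows "rep (\<Sqinter>A) = X \<inter> \<Inter>(rep ` A)"
proof -
  have "X \<inter> \<Inter>(rep ` A) \<in> Pow X" by blast
  then obtain i where i: "i \<in> carrier L" "rep i = X \<inter> \<Inter>(rep ` A)" by (rule rep_cases)
  have "\<Sqinter>A = i"
    by (rule greatest_unique[OF inf_glb[OF A] greatest_Lower_if_rep_eq[OF A i]])
  then show ?thesis using i by simp
qed

lemma rep_join: "x \<in> carrier L \<Longrightarrow> y \<in> carrier L \<Longrightarrow> rep (x \<squnion> y) = rep x \<union> rep y"
  by (simp add: join_def rep_Sup)

lemma rep_meet: "x \<in> carrier L \<Longrightarrow> y \<in> carrier L \<Longrightarrow> rep (x \<sqinter> y) = rep x \<inter> rep y"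
  using rep_closed[of x] by (auto simp: meet_def rep_Inf)

lemma rep_bottom: "rep \<bottom> = {}"
proof -
  obtain z where z: "z \<in> carrier L" "rep z = {}" using rep_cases[of "{}"] by auto
  then show ?thesis using le_iff_subset[of \<bottom> z] bottom_lower[of z] by simp
qed

lemma rep_top: "rep \<top> = X"
proof -
  obtain z where z: "z \<in> carrier L" "rep z = X" using rep_cases[of X] by auto
  then show ?thesis using le_iff_subset[of z \<top>] top_higher[of z] rep_closed[of \<top>] by auto
qed

lemma in_lattice_atoms_if_rep_singleton:
  assumes x: "x \<in> carrier L" "rep x = {a}"
  shows "x \<in> lattice_atoms L"
proof -
  have "y = \<bottom> \<or> y = x" if "y \<in> carrier L" "y \<sqsubseteq> x" for y
    using that x le_iff_subset[of y x]
    by (auto simp: rep_eq_iff[symmetric] rep_bottom subset_singleton_iff)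
  then show ?thesis using x rep_bottom by (auto simp: lattice_atoms_def)
qed

lemma eq_Sup_lattice_atoms:
  assumes x: "x \<in> carrier L"
  shows "x = \<Squnion>{a \<in> lattice_atoms L. a \<sqsubseteq> x}" (is "_ = \<Squnion>?A")
proof -
  have A: "?A \<subseteq> carrier L" by (auto simp: lattice_atoms_def)
  have "p \<in> \<Union>(rep ` ?A)" if "p \<in> rep x" for p
  proof -
    have "{p} \<in> Pow X" using that rep_closed[OF x] by auto
    then obtain a where a: "a \<in> carrier L" "rep a = {p}" by (rule rep_cases)
    then have "a \<in> ?A" using in_lattice_atoms_if_rep_singleton le_iff_subset[of a x] x that by simp
    then show ?thesis using a by blast
  qed
  moreover have "\<Union>(rep ` ?A) \<subseteq> rep x" using A x le_iff_subset by blast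
  ultimately have "rep x = rep (\<Squnion>?A)" unfolding rep_Sup[OF A] by blast
  then show ?thesis using rep_eq_iff[OF x sup_closed[OF A]] by simp
qed

theorem complete_atomic_boolean_algebra:
  assumes "X \<noteq> {}"
  shows "complete_atomic_boolean_algebra L"
  unfolding complete_atomic_boolean_algebra_def
proof (intro conjI ballI)
  show "complete_lattice L" by unfold_locales
  show "x \<sqinter> (y \<squnion> z) = (x \<sqinter> y) \<squnion> (x \<sqinter> z)"
    if "x \<in> carrier L" "y \<in> carrier L" "z \<in> carrier L" for x y z
    using that by (simp add: rep_eq_iff[symmetric] rep_meet rep_join Int_Un_distrib)
  show "\<exists>y\<in>carrier L. x \<sqinter> y = \<bottom> \<and> x \<squnion> y = \<top>" if x: "x \<in> carrier L" for x
  proof -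
    obtain y where "y \<in> carrier L" "rep y = X - rep x" using rep_cases[of "X - rep x"] by auto
    then show ?thesis
      using x rep_closed[OF x]
      by (auto simp: rep_eq_iff[symmetric] rep_meet rep_join rep_bottom rep_top
          intro!: bexI[of _ y])
  qed
  show "\<bottom> \<noteq> \<top>" using assms rep_bottom rep_top by auto
qed (rule eq_Sup_lattice_atoms)

end

subsection \<open>Complete atomic Boolean algebras\<close>

locale complete_atomic_boolean_lattice =
  fixes L :: "('a, 'b) gorder_scheme" (structure)
  assumes complete_atomic_boolean: "complete_atomic_boolean_algebra L"
begin

sublocale complete_lattice L
  using complete_atomic_boolean by (simp add: complete_atomic_boolean_algebra_def)

lemma lattice_atoms_subset: "lattice_atoms L \<subseteq> carrier L"
  by (auto simp: lattice_atoms_def)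

lemma meet_join_distrib:
  "x \<in> carrier L \<Longrightarrow> y \<in> carrier L \<Longrightarrow> z \<in> carrier L \<Longrightarrow> x \<sqinter> (y \<squnion> z) = (x \<sqinter> y) \<squnion> (x \<sqinter> z)"
  using complete_atomic_boolean by (simp add: complete_atomic_boolean_algebra_def)

lemma complement_exists:
  assumes "x \<in> carrier L"
  obtains y where "y \<in> carrier L" "x \<sqinter> y = \<bottom>" "x \<squnion> y = \<top>"
  using assms complete_atomic_boolean by (auto simp: complete_atomic_boolean_algebra_def)

lemma Sup_lattice_atoms_below: "x \<in> carrier L \<Longrightarrow> \<Squnion>{a \<in> lattice_atoms L. a \<sqsubseteq> x} = x"
  using complete_atomic_boolean by (simp add: complete_atomic_boolean_algebra_def)

lemma le_complement:
  assumes carrier: "x \<in> carrier L" "y \<in> carrier L" "z \<in> carrier L"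
    and disjoint: "x \<sqinter> y = \<bottom>" and cover: "y \<squnion> z = \<top>"
  shows "x \<sqsubseteq> z"
proof -
  have "x = x \<sqinter> (y \<squnion> z)"
    using carrier top_meet[of x] by (simp add: cover meet_comm[of L x] eq_is_equal)
  also have "\<dots> = x \<sqinter> z"
    using carrier bottom_join[of "x \<sqinter> z"] by (simp add: meet_join_distrib disjoint eq_is_equal)
  finally show ?thesis using meet_right[OF carrier(1,3)] by simp
qed

lemma lattice_atoms_meet:
  assumes a: "a \<in> lattice_atoms L" and b: "b \<in> lattice_atoms L" and "a \<noteq> b"
  shows "a \<sqinter> b = \<bottom>"
proof -
  have carrier: "a \<in> carrier L" "b \<in> carrier L" using a b lattice_atoms_subset by auto
  have "a \<sqinter> b = \<bottom> \<or> a \<sqinter> b = a" "a \<sqinter> b = \<bottom> \<or> a \<sqinter> b = b"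
    using a b meet_left[OF carrier] meet_right[OF carrier] meet_closed[OF carrier]
    by (simp_all add: lattice_atoms_def)
  then show ?thesis using \<open>a \<noteq> b\<close> by auto
qed

text \<open>If \<open>a \<notin> T\<close>, every member of \<open>T\<close> lies below the complement of \<open>a\<close>, hence so does \<open>\<Squnion>T\<close>.\<close>
lemma lattice_atom_le_Sup_iff:
  assumes T: "T \<subseteq> lattice_atoms L" and a: "a \<in> lattice_atoms L"
  shows "a \<sqsubseteq> \<Squnion>T \<longleftrightarrow> a \<in> T"
proof
  have carrier: "T \<subseteq> carrier L" "a \<in> carrier L" using T a lattice_atoms_subset by auto
  show "a \<sqsubseteq> \<Squnion>T" if "a \<in> T" using sup_upper[OF carrier(1) that] .
  assume a_le_Sup: "a \<sqsubseteq> \<Squnion>T"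
  show "a \<in> T"
  proof (rule ccontr)
    assume "a \<notin> T"
    obtain b where b: "b \<in> carrier L" "a \<sqinter> b = \<bottom>" "a \<squnion> b = \<top>"
      by (rule complement_exists[OF carrier(2)])
    have "t \<sqsubseteq> b" if "t \<in> T" for t
    proof (rule le_complement[OF _ carrier(2) b(1) _ b(3)])
      show "t \<in> carrier L" using that carrier(1) by auto
      show "t \<sqinter> a = \<bottom>" using that T \<open>a \<notin> T\<close> by (intro lattice_atoms_meet a) auto
    qed
    then have "\<Squnion>T \<sqsubseteq> b" using carrier(1) b(1) by (intro sup_least) auto
    then have "a \<sqsubseteq> b" by (rule le_trans[OF a_le_Sup]) (use carrier b(1) in auto)
    then have "a \<sqinter> b = a" using carrier(2) b(1) le_iff_join by simp
    then show False using a b(2) by (simp add: lattice_atoms_def)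
  qed
qed

sublocale atoms: powerset_representation L "\<lambda>x. {a \<in> lattice_atoms L. a \<sqsubseteq> x}" "lattice_atoms L"
proof
  show "(.=) = (=)" by (rule eq_is_equal)
  show "x \<sqsubseteq> y \<longleftrightarrow> {a \<in> lattice_atoms L. a \<sqsubseteq> x} \<subseteq> {a \<in> lattice_atoms L. a \<sqsubseteq> y}"
    if x: "x \<in> carrier L" and y: "y \<in> carrier L" for x y
  proof
    show "{a \<in> lattice_atoms L. a \<sqsubseteq> x} \<subseteq> {a \<in> lattice_atoms L. a \<sqsubseteq> y}" if "x \<sqsubseteq> y"
      using le_trans[OF _ that] lattice_atoms_subset x y by auto
    assume "{a \<in> lattice_atoms L. a \<sqsubseteq> x} \<subseteq> {a \<in> lattice_atoms L. a \<sqsubseteq> y}"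
    then have "\<Squnion>{a \<in> lattice_atoms L. a \<sqsubseteq> x} \<sqsubseteq> y"
      using lattice_atoms_subset y by (intro sup_least) auto
    then show "x \<sqsubseteq> y" by (simp add: Sup_lattice_atoms_below[OF x])
  qed
  show "bij_betw (\<lambda>x. {a \<in> lattice_atoms L. a \<sqsubseteq> x}) (carrier L) (Pow (lattice_atoms L))"
  proof (rule bij_betwI)
    show "(\<lambda>T. \<Squnion>T) \<in> Pow (lattice_atoms L) \<rightarrow> carrier L" using lattice_atoms_subset by auto
    show "{a \<in> lattice_atoms L. a \<sqsubseteq> \<Squnion>T} = T" if "T \<in> Pow (lattice_atoms L)" for T
      using that lattice_atom_le_Sup_iff[of T] by auto
  qed (auto simp: Sup_lattice_atoms_below)
qed

end

subsection \<open>Bottomless Boolean algebras\<close>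

lemma adjoin_bottom_simps [simp]:
  "carrier (adjoin_bottom L) = insert None (Some ` carrier L)"
  "eq (adjoin_bottom L) = (=)"
  "None \<sqsubseteq>\<^bsub>adjoin_bottom L\<^esub> y"
  "Some a \<sqsubseteq>\<^bsub>adjoin_bottom L\<^esub> Some b \<longleftrightarrow> a \<sqsubseteq>\<^bsub>L\<^esub> b"
  "\<not> Some a \<sqsubseteq>\<^bsub>adjoin_bottom L\<^esub> None"
  by (auto simp: adjoin_bottom_def)

lemma atoms_below_subset: "atoms_below L x \<subseteq> minimals L"
  by (auto simp: atoms_below_def)

lemma minimals_subset: "minimals L \<subseteq> carrier L"
  by (auto simp: minimals_def)

lemma atoms_below_carrier: "atoms_below L x \<subseteq> carrier L"
  by (auto simp: atoms_below_def minimals_def)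

lemma (in partial_order) atoms_below_minimal: "x \<in> minimals L \<Longrightarrow> atoms_below L x = {x}"
  by (auto simp: atoms_below_def minimals_def)

locale nonempty_powerset_representation = set_representation L rep "Pow_ne X"
  for L :: "'a gorder" (structure) and rep :: "'a \<Rightarrow> 'c set" and X +
  assumes nonempty: "X \<noteq> {}"
begin

lemma rep_nonempty: "x \<in> carrier L \<Longrightarrow> rep x \<noteq> {}"
  using rep_closed by (auto simp: Pow_ne_def)

lemma rep_subset: "x \<in> carrier L \<Longrightarrow> rep x \<subseteq> X"
  using rep_closed by (auto simp: Pow_ne_def)

lemma Union_rep_in_Pow_ne:
  assumes "A \<subseteq> carrier L" "A \<noteq> {}"
  shows "\<Union>(rep ` A) \<in> Pow_ne X"
proof -
  have "\<Union>(rep ` A) \<noteq> {}" using assms rep_nonempty by blast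
  moreover have "\<Union>(rep ` A) \<subseteq> X" using assms rep_subset by blast
  ultimately show ?thesis by (simp add: Pow_ne_def)
qed

lemma Sup_in_carrier: "A \<subseteq> carrier L \<Longrightarrow> A \<noteq> {} \<Longrightarrow> \<Squnion>A \<in> carrier L"
  by (intro sup_in_carrier_if_Union Union_rep_in_Pow_ne)

lemma rep_Sup: "A \<subseteq> carrier L \<Longrightarrow> A \<noteq> {} \<Longrightarrow> rep (\<Squnion>A) = \<Union>(rep ` A)"
  by (intro rep_sup_if_Union Union_rep_in_Pow_ne)

definition atom :: "'c \<Rightarrow> 'a" where
  "atom p = inv_into (carrier L) rep {p}"

lemma
  assumes "p \<in> X"
  shows atom_in_carrier: "atom p \<in> carrier L" and rep_atom: "rep (atom p) = {p}"
proof -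
  have "{p} \<in> rep ` carrier L" using assms bij by (auto simp: bij_betw_def Pow_ne_def)
  then show "atom p \<in> carrier L" "rep (atom p) = {p}"
    unfolding atom_def by (rule inv_into_into, rule f_inv_into_f)
qed

lemma atom_le_iff: "p \<in> X \<Longrightarrow> x \<in> carrier L \<Longrightarrow> atom p \<sqsubseteq> x \<longleftrightarrow> p \<in> rep x"
  by (simp add: le_iff_subset atom_in_carrier rep_atom)

lemma minimals_eq: "minimals L = atom ` X"
proof
  show "atom ` X \<subseteq> minimals L"
    unfolding minimals_def
    using atom_in_carrier rep_atom rep_nonempty by (force simp: le_iff_subset rep_eq_iff[symmetric])
  show "minimals L \<subseteq> atom ` X"
  proof
    fix x assume x: "x \<in> minimals L"
    then have carrier: "x \<in> carrier L" by (simp add: minimals_def)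
    then obtain p where p: "p \<in> rep x" "p \<in> X" using rep_nonempty rep_subset by blast
    then have "atom p = x" using x carrier by (simp add: minimals_def atom_le_iff atom_in_carrier)
    then show "x \<in> atom ` X" using p by auto
  qed
qed

lemma atoms_below_eq: "x \<in> carrier L \<Longrightarrow> atoms_below L x = atom ` rep x"
  unfolding atoms_below_def minimals_eq using rep_subset[of x] atom_le_iff[of _ x] by auto

lemma Sup_atoms_below:
  assumes x: "x \<in> carrier L"
  shows "\<Squnion>(atoms_below L x) = x"
proof -
  have A: "atoms_below L x \<subseteq> carrier L" "atoms_below L x \<noteq> {}"
    using atoms_below_carrier[of L x] atoms_below_eq[OF x] rep_nonempty[OF x] by simp_all
  have "rep (\<Squnion>(atoms_below L x)) = (\<Union>p\<in>rep x. rep (atom p))"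
    unfolding rep_Sup[OF A] by (simp add: atoms_below_eq[OF x])
  also have "\<dots> = rep x" using rep_subset[OF x] rep_atom by auto
  finally show ?thesis using rep_eq_iff Sup_in_carrier[OF A] x by simp
qed

lemma minimals_iff: "x \<in> minimals L \<longleftrightarrow> x \<in> carrier L \<and> (\<exists>p. rep x = {p})"
proof
  show "x \<in> carrier L \<and> (\<exists>p. rep x = {p})" if "x \<in> minimals L"
    using that by (auto simp: minimals_eq atom_in_carrier rep_atom)
  assume "x \<in> carrier L \<and> (\<exists>p. rep x = {p})"
  then obtain p where x: "x \<in> carrier L" "rep x = {p}" by auto
  then have "p \<in> X" using rep_subset by auto
  then have "x = atom p" using x by (simp add: rep_eq_iff[symmetric] rep_atom atom_in_carrier)
  then show "x \<in> minimals L" using \<open>p \<in> X\<close> by (simp add: minimals_eq)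
qed

theorem bottomless_boolean_algebra: "bottomless_boolean_algebra L"
proof -
  let ?rep = "case_option {} rep"
  interpret adjoined: powerset_representation "adjoin_bottom L" ?rep X
  proof
    show "x \<sqsubseteq>\<^bsub>adjoin_bottom L\<^esub> y \<longleftrightarrow> ?rep x \<subseteq> ?rep y"
      if "x \<in> carrier (adjoin_bottom L)" "y \<in> carrier (adjoin_bottom L)" for x y
      using that rep_nonempty by (cases x; cases y) (auto simp: le_iff_subset)
    show "bij_betw ?rep (carrier (adjoin_bottom L)) (Pow X)"
    proof (rule bij_betw_imageI)
      show "inj_on ?rep (carrier (adjoin_bottom L))"
        using rep_nonempty by (auto simp: inj_on_def rep_eq_iff)
      have "?rep ` carrier (adjoin_bottom L) = insert {} (rep ` carrier L)"
        by (simp add: image_image)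
      also have "\<dots> = insert {} (Pow_ne X)" using bij by (simp add: bij_betw_def)
      also have "\<dots> = Pow X" by (auto simp: Pow_ne_def)
      finally show "?rep ` carrier (adjoin_bottom L) = Pow X" .
    qed
  qed simp
  show ?thesis
    unfolding bottomless_boolean_algebra_def
    using adjoined.complete_atomic_boolean_algebra[OF nonempty] partial_order_axioms
      nonempty atom_in_carrier by auto
qed

end

locale bottomless_boolean_order =
  fixes L :: "'a gorder" (structure)
  assumes bottomless: "bottomless_boolean_algebra L"
begin

sublocale partial_order L
  using bottomless by (simp add: bottomless_boolean_algebra_def)

sublocale adjoined: complete_atomic_boolean_lattice "adjoin_bottom L"
  using bottomless by unfold_locales (simp add: bottomless_boolean_algebra_def)

lemma bottom_adjoin_bottom: "\<bottom>\<^bsub>adjoin_bottom L\<^esub> = None"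
  using adjoined.bottom_lower[of None] adjoined.bottom_closed
  by (cases "\<bottom>\<^bsub>adjoin_bottom L\<^esub>") auto

lemma lattice_atoms_adjoin_bottom: "lattice_atoms (adjoin_bottom L) = Some ` minimals L"
  by (auto simp: lattice_atoms_def minimals_def bottom_adjoin_bottom)

lemma lattice_atoms_le_Some:
  "{a \<in> lattice_atoms (adjoin_bottom L). a \<sqsubseteq>\<^bsub>adjoin_bottom L\<^esub> Some x} = Some ` atoms_below L x"
  by (auto simp: lattice_atoms_adjoin_bottom atoms_below_def)

lemma lattice_atoms_le_None:
  "{a \<in> lattice_atoms (adjoin_bottom L). a \<sqsubseteq>\<^bsub>adjoin_bottom L\<^esub> None} = {}"
  by (auto simp: lattice_atoms_adjoin_bottom)

lemma le_iff_atoms_below_subset: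
  "x \<in> carrier L \<Longrightarrow> y \<in> carrier L \<Longrightarrow> x \<sqsubseteq> y \<longleftrightarrow> atoms_below L x \<subseteq> atoms_below L y"
  using adjoined.atoms.le_iff_subset[of "Some x" "Some y"]
  unfolding lattice_atoms_le_Some by (simp add: inj_image_subset_iff)

lemma atoms_below_in_Pow_ne:
  assumes "x \<in> carrier L"
  shows "atoms_below L x \<in> Pow_ne (minimals L)"
proof -
  have "atoms_below L x \<noteq> {}"
    using adjoined.atoms.rep_eq_iff[of "Some x" None] assms
    unfolding lattice_atoms_le_Some lattice_atoms_le_None by simp
  then show ?thesis using atoms_below_subset[of L x] by (simp add: Pow_ne_def)
qed

lemma atoms_below_cases:
  assumes T: "T \<in> Pow_ne (minimals L)"
  obtains x where "x \<in> carrier L" "atoms_below L x = T"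
proof -
  have "Some ` T \<in> Pow (lattice_atoms (adjoin_bottom L))"
    using T by (auto simp: lattice_atoms_adjoin_bottom Pow_ne_def)
  then obtain y where y: "y \<in> carrier (adjoin_bottom L)"
    "{a \<in> lattice_atoms (adjoin_bottom L). a \<sqsubseteq>\<^bsub>adjoin_bottom L\<^esub> y} = Some ` T"
    by (rule adjoined.atoms.rep_cases)
  show ?thesis
  proof (cases y)
    case None
    then show ?thesis using y(2) lattice_atoms_le_None T by (simp add: Pow_ne_def)
  next
    case (Some x)
    then have "Some ` atoms_below L x = Some ` T" using y(2) lattice_atoms_le_Some by simp
    then show ?thesis using that y(1) Some by (auto simp: inj_image_eq_iff)
  qed
qed

sublocale atoms: nonempty_powerset_representation L "atoms_below L" "minimals L"
proof
  show "bij_betw (atoms_below L) (carrier L) (Pow_ne (minimals L))"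
  proof (rule bij_betw_imageI)
    show "inj_on (atoms_below L) (carrier L)"
      by (intro inj_onI le_antisym) (simp_all add: le_iff_atoms_below_subset)
    show "atoms_below L ` carrier L = Pow_ne (minimals L)"
      using atoms_below_in_Pow_ne by (auto elim: atoms_below_cases)
  qed
  have "carrier L \<noteq> {}" using bottomless by (simp add: bottomless_boolean_algebra_def)
  then show "minimals L \<noteq> {}" using atoms_below_in_Pow_ne by (auto simp: Pow_ne_def)
qed (simp_all add: eq_is_equal le_iff_atoms_below_subset)

end

section \<open>Ordered algebras represented by multialgebras\<close>

lemma listset_map_image: "listset (map ((`) f) Xs) = map f ` listset Xs"
proof (induction Xs)
  case (Cons X Xs)
  then show ?case by (force simp: set_Cons_def image_iff)
qed simp

lemma listset_map_singleton: "listset (map (\<lambda>x. {x}) xs) = {xs}"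
  by (induction xs) (auto simp: set_Cons_def)

lemma listset_nonempty: "{} \<notin> set Xs \<Longrightarrow> listset Xs \<noteq> {}"
  by (induction Xs) (auto simp: set_Cons_def)

lemma op_dom_iff: "(\<sigma>, xs) \<in> op_dom S A \<longleftrightarrow> \<sigma> \<in> S (length xs) \<and> set xs \<subseteq> A"
  by (simp add: op_dom_def)

lemma op_dom_map: "(\<sigma>, xs) \<in> op_dom S A \<Longrightarrow> h ` A \<subseteq> B \<Longrightarrow> (\<sigma>, map h xs) \<in> op_dom S B"
  by (auto simp: op_dom_iff)

lemma listset_op_dom:
  assumes "(\<sigma>, Xs) \<in> op_dom S (Pow_ne A)" "xs \<in> listset Xs"
  shows "(\<sigma>, xs) \<in> op_dom S A"
proof -
  have "length xs = length Xs \<and> set xs \<subseteq> \<Union>(set Xs)" using assms(2)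
    by (induction Xs arbitrary: xs) (fastforce simp: set_Cons_def)+
  then show ?thesis using assms(1) by (auto simp: op_dom_iff Pow_ne_def)
qed

lemma listset_op_dom_nonempty: "(\<sigma>, Xs) \<in> op_dom S (Pow_ne A) \<Longrightarrow> listset Xs \<noteq> {}"
  by (intro listset_nonempty) (auto simp: op_dom_iff Pow_ne_def)

lemma map_restrict_op_dom: "(\<sigma>, xs) \<in> op_dom S A \<Longrightarrow> map (restrict f A) xs = map f xs"
  by (auto simp: op_dom_iff subset_iff)

lemma mop_in_Pow_ne:
  "multialgebra S M \<Longrightarrow> (\<sigma>, xs) \<in> op_dom S (mcarr M) \<Longrightarrow> mop M (\<sigma>, xs) \<in> Pow_ne (mcarr M)"
  unfolding multialgebra_def by blast

lemma mop_subset: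
  "multialgebra S M \<Longrightarrow> (\<sigma>, xs) \<in> op_dom S (mcarr M) \<Longrightarrow> mop M (\<sigma>, xs) \<subseteq> mcarr M"
  using mop_in_Pow_ne[of S M \<sigma> xs] by (simp add: Pow_ne_def)

lemma malg_hom_iff:
  "h \<in> malg_hom S M N \<longleftrightarrow> h \<in> mcarr M \<rightarrow>\<^sub>E mcarr N \<and>
     (\<forall>\<sigma> xs. (\<sigma>, xs) \<in> op_dom S (mcarr M) \<longrightarrow> h ` mop M (\<sigma>, xs) \<subseteq> mop N (\<sigma>, map h xs))"
  by (auto simp: malg_hom_def Ball_def)

lemma ord_of_simps [simp]:
  "carrier (ord_of B) = bcarr B"
  "x \<sqsubseteq>\<^bsub>ord_of B\<^esub> y \<longleftrightarrow> (x, y) \<in> ble B"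
  "eq (ord_of B) = (=)"
  by (simp_all add: ord_of_def)

abbreviation atoms :: "('s, 'a) balg \<Rightarrow> 'a set" where
  "atoms B \<equiv> minimals (ord_of B)"

abbreviation at_below :: "('s, 'a) balg \<Rightarrow> 'a \<Rightarrow> 'a set" where
  "at_below B \<equiv> atoms_below (ord_of B)"

locale represented_algebra =
  fixes S :: "nat \<Rightarrow> 's set" and B :: "('s, 'b) balg" and M :: "('s, 'a) malg"
    and rep :: "'b \<Rightarrow> 'a set"
  assumes multialgebra: "multialgebra S M"
    and bop_PiE: "bop B \<in> op_dom S (bcarr B) \<rightarrow>\<^sub>E bcarr B"
    and ble_subset: "ble B \<subseteq> bcarr B \<times> bcarr B"
    and representation: "nonempty_powerset_representation (ord_of B) rep (mcarr M)"
    and rep_bop: "(\<sigma>, xs) \<in> op_dom S (bcarr B) \<Longrightarrow>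
      rep (bop B (\<sigma>, xs)) = (\<Union>ps\<in>listset (map rep xs). mop M (\<sigma>, ps))"
begin

sublocale nonempty_powerset_representation "ord_of B" rep "mcarr M"
  by (rule representation)

lemma bop_in_carrier: "(\<sigma>, xs) \<in> op_dom S (bcarr B) \<Longrightarrow> bop B (\<sigma>, xs) \<in> bcarr B"
  using bop_PiE by blast

lemma image_restrict_id_rep: "x \<in> bcarr B \<Longrightarrow> (\<lambda>p\<in>mcarr M. p) ` rep x = rep x"
  using rep_subset[of x] by force

lemma map_rep_op_dom:
  "(\<sigma>, xs) \<in> op_dom S (bcarr B) \<Longrightarrow> (\<sigma>, map rep xs) \<in> op_dom S (Pow_ne (mcarr M))"
  using rep_closed by (intro op_dom_map) auto

lemma map_atom_op_dom: "(\<sigma>, ps) \<in> op_dom S (mcarr M) \<Longrightarrow> (\<sigma>, map atom ps) \<in> op_dom S (bcarr B)"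
  using atom_in_carrier by (intro op_dom_map) auto

lemma map_rep_atom: "(\<sigma>, ps) \<in> op_dom S (mcarr M) \<Longrightarrow> map (rep \<circ> atom) ps = map (\<lambda>p. {p}) ps"
  using rep_atom by (auto simp: op_dom_iff)

lemma rep_bop_atoms:
  assumes "(\<sigma>, ps) \<in> op_dom S (mcarr M)"
  shows "rep (bop B (\<sigma>, map atom ps)) = mop M (\<sigma>, ps)"
  using assms by (simp add: rep_bop map_atom_op_dom map_rep_atom listset_map_singleton)

theorem ordered_algebra: "ordered_algebra S B"
proof -
  have "bop B (\<sigma>, xs) = \<Squnion>\<^bsub>ord_of B\<^esub>{bop B (\<sigma>, ys) | ys. ys \<in> listset (map (at_below B) xs)}"
    (is "_ = \<Squnion>\<^bsub>_\<^esub>?Y") if xs: "(\<sigma>, xs) \<in> op_dom S (bcarr B)" for \<sigma> xs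
  proof -
    have points_op_dom: "(\<sigma>, ps) \<in> op_dom S (mcarr M)" if "ps \<in> listset (map rep xs)" for ps
      by (rule listset_op_dom[OF map_rep_op_dom[OF xs] that])
    have "map (at_below B) xs = map ((`) atom) (map rep xs)"
      using xs atoms_below_eq by (auto simp: op_dom_iff)
    then have "listset (map (at_below B) xs) = map atom ` listset (map rep xs)"
      by (simp only: listset_map_image)
    then have Y_eq: "?Y = (\<lambda>ps. bop B (\<sigma>, map atom ps)) ` listset (map rep xs)" by auto
    have Y: "?Y \<subseteq> carrier (ord_of B)" "?Y \<noteq> {}"
      unfolding Y_eq using bop_in_carrier[OF map_atom_op_dom[OF points_op_dom]]
        listset_op_dom_nonempty[OF map_rep_op_dom[OF xs]] by auto
    have "rep (\<Squnion>\<^bsub>ord_of B\<^esub>?Y) = \<Union>(rep ` ?Y)" by (rule rep_Sup[OF Y])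
    also have "\<dots> = (\<Union>ps\<in>listset (map rep xs). rep (bop B (\<sigma>, map atom ps)))"
      unfolding Y_eq by simp
    also have "\<dots> = rep (bop B (\<sigma>, xs))"
      using points_op_dom by (simp add: rep_bop[OF xs] rep_bop_atoms)
    finally show ?thesis
      using rep_eq_iff bop_in_carrier[OF xs] Sup_in_carrier[OF Y] by simp
  qed
  then show ?thesis
    using bop_PiE ble_subset bottomless_boolean_algebra by (auto simp: ordered_algebra_def)
qed

end

theorem represented_algebra_atoms:
  fixes B :: "('s, 'b) balg"
  assumes B: "ordered_algebra S B"
  shows "represented_algebra S B (A_malg S B) (at_below B)"
proof -
  have "bottomless_boolean_order (ord_of B)"
    using B by unfold_locales (simp add: ordered_algebra_def)
  then interpret bottomless_boolean_order "ord_of B" .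
  have bop_in_bcarr: "bop B (\<sigma>, xs) \<in> bcarr B" if "(\<sigma>, xs) \<in> op_dom S (bcarr B)" for \<sigma> xs
    using B that by (auto simp: ordered_algebra_def)
  have atoms_op_dom: "(\<sigma>, xs) \<in> op_dom S (bcarr B)" if "(\<sigma>, xs) \<in> op_dom S (atoms B)" for \<sigma> xs
    using that minimals_subset[of "ord_of B"] by (auto simp: op_dom_iff)
  show ?thesis
  proof (rule represented_algebra.intro)
    have "at_below B (bop B (\<sigma>, xs)) \<in> Pow_ne (atoms B)"
      if "(\<sigma>, xs) \<in> op_dom S (atoms B)" for \<sigma> xs
      using atoms.rep_closed bop_in_bcarr[OF atoms_op_dom[OF that]] by simp
    then show "multialgebra S (A_malg S B)"
      using atoms.nonempty by (auto simp: multialgebra_def A_malg_def)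
    fix \<sigma> xs assume xs: "(\<sigma>, xs) \<in> op_dom S (bcarr B)"
    let ?Y = "{bop B (\<sigma>, ys) | ys. ys \<in> listset (map (at_below B) xs)}"
    have map_op_dom: "(\<sigma>, map (at_below B) xs) \<in> op_dom S (Pow_ne (atoms B))"
      using atoms.rep_closed by (intro op_dom_map[OF xs]) auto
    note atom_lists_op_dom = listset_op_dom[OF map_op_dom]
    have Y: "?Y \<subseteq> carrier (ord_of B)" "?Y \<noteq> {}"
      using bop_in_bcarr[OF atoms_op_dom[OF atom_lists_op_dom]]
        listset_op_dom_nonempty[OF map_op_dom] by auto
    have "bop B (\<sigma>, xs) = \<Squnion>\<^bsub>ord_of B\<^esub>?Y" using B xs by (auto simp: ordered_algebra_def)
    then have "at_below B (bop B (\<sigma>, xs)) = \<Union>(at_below B ` ?Y)" using atoms.rep_Sup[OF Y] by simp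
    also have "\<dots> = (\<Union>ys\<in>listset (map (at_below B) xs). mop (A_malg S B) (\<sigma>, ys))"
      using atom_lists_op_dom by (auto simp: A_malg_def)
    finally show "at_below B (bop B (\<sigma>, xs)) =
      (\<Union>ys\<in>listset (map (at_below B) xs). mop (A_malg S B) (\<sigma>, ys))" .
  qed (use B atoms.nonempty_powerset_representation_axioms
      in \<open>simp_all add: ordered_algebra_def A_malg_def\<close>)
qed

subsection \<open>Homomorphisms\<close>

locale represented_map =
  A: represented_algebra S A M repA + B: represented_algebra S B N repB
  for S :: "nat \<Rightarrow> 's set"
    and A :: "('s, 'a) balg" and M :: "('s, 'c) malg" and repA
    and B :: "('s, 'b) balg" and N :: "('s, 'd) malg" and repB +
  fixes h :: "'a \<Rightarrow> 'b" and k :: "'c \<Rightarrow> 'd"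
  assumes h_PiE: "h \<in> bcarr A \<rightarrow>\<^sub>E bcarr B"
    and k_PiE: "k \<in> mcarr M \<rightarrow>\<^sub>E mcarr N"
    and rep_h: "x \<in> bcarr A \<Longrightarrow> repB (h x) = k ` repA x"
begin

lemma map_h_op_dom: "(\<sigma>, xs) \<in> op_dom S (bcarr A) \<Longrightarrow> (\<sigma>, map h xs) \<in> op_dom S (bcarr B)"
  using h_PiE by (intro op_dom_map) auto

lemma h_Sup:
  assumes X: "X \<subseteq> bcarr A" "X \<noteq> {}"
  shows "h (\<Squnion>\<^bsub>ord_of A\<^esub>X) = \<Squnion>\<^bsub>ord_of B\<^esub>(h ` X)"
proof -
  have X_carrier: "X \<subseteq> carrier (ord_of A)" using X by simp
  have hX: "h ` X \<subseteq> carrier (ord_of B)" "h ` X \<noteq> {}" using h_PiE X by auto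
  have Sup: "\<Squnion>\<^bsub>ord_of A\<^esub>X \<in> bcarr A" using A.Sup_in_carrier[OF X_carrier X(2)] by simp
  have "repB (h (\<Squnion>\<^bsub>ord_of A\<^esub>X)) = (\<Union>x\<in>X. k ` repA x)"
    unfolding rep_h[OF Sup] A.rep_Sup[OF X_carrier X(2)] by (rule image_UN)
  also have "\<dots> = repB (\<Squnion>\<^bsub>ord_of B\<^esub>(h ` X))"
    unfolding B.rep_Sup[OF hX] image_image using rep_h X(1) by (intro SUP_cong) auto
  finally show ?thesis
    using B.rep_eq_iff[of "h (\<Squnion>\<^bsub>ord_of A\<^esub>X)"] B.Sup_in_carrier[OF hX] h_PiE Sup by auto
qed

lemma h_atoms: "h ` atoms A \<subseteq> atoms B"
  using h_PiE by (auto simp: A.minimals_iff B.minimals_iff rep_h)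

lemma h_bop_le_iff:
  assumes xs: "(\<sigma>, xs) \<in> op_dom S (bcarr A)"
  shows "h (bop A (\<sigma>, xs)) \<sqsubseteq>\<^bsub>ord_of B\<^esub> bop B (\<sigma>, map h xs) \<longleftrightarrow>
    k ` repA (bop A (\<sigma>, xs)) \<subseteq> repB (bop B (\<sigma>, map h xs))"
proof -
  have "bop A (\<sigma>, xs) \<in> bcarr A" by (rule A.bop_in_carrier[OF xs])
  moreover from this have "h (bop A (\<sigma>, xs)) \<in> bcarr B" using h_PiE by auto
  ultimately show ?thesis
    using B.le_iff_subset[of "h (bop A (\<sigma>, xs))"] B.bop_in_carrier[OF map_h_op_dom[OF xs]] rep_h
    by simp
qed

theorem hom_iff: "h \<in> balg_hom S A B \<longleftrightarrow> k \<in> malg_hom S M N"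
proof
  assume h: "h \<in> balg_hom S A B"
  have "k ` mop M (\<sigma>, ps) \<subseteq> mop N (\<sigma>, map k ps)" if ps: "(\<sigma>, ps) \<in> op_dom S (mcarr M)" for \<sigma> ps
  proof -
    let ?xs = "map A.atom ps"
    have xs: "(\<sigma>, ?xs) \<in> op_dom S (bcarr A)" by (rule A.map_atom_op_dom[OF ps])
    have "map repB (map h ?xs) = map (\<lambda>p. {p}) (map k ps)"
      using ps rep_h A.atom_in_carrier A.rep_atom by (auto simp: op_dom_iff subset_iff)
    then have "repB (bop B (\<sigma>, map h ?xs)) = mop N (\<sigma>, map k ps)"
      unfolding B.rep_bop[OF map_h_op_dom[OF xs]] by (simp only: listset_map_singleton) simp
    moreover have "h (bop A (\<sigma>, ?xs)) \<sqsubseteq>\<^bsub>ord_of B\<^esub> bop B (\<sigma>, map h ?xs)"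
      using h xs by (auto simp: balg_hom_def)
    ultimately show ?thesis using h_bop_le_iff[OF xs] A.rep_bop_atoms[OF ps] by simp
  qed
  then show "k \<in> malg_hom S M N" using k_PiE by (simp add: malg_hom_iff)
next
  assume k: "k \<in> malg_hom S M N"
  have "k ` repA (bop A (\<sigma>, xs)) \<subseteq> repB (bop B (\<sigma>, map h xs))"
    if xs: "(\<sigma>, xs) \<in> op_dom S (bcarr A)" for \<sigma> xs
  proof -
    have "map repB (map h xs) = map ((`) k) (map repA xs)"
      using xs rep_h by (auto simp: op_dom_iff)
    then have listset_eq: "listset (map repB (map h xs)) = map k ` listset (map repA xs)"
      by (simp only: listset_map_image)
    have "k ` repA (bop A (\<sigma>, xs)) = (\<Union>ps\<in>listset (map repA xs). k ` mop M (\<sigma>, ps))"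
      unfolding A.rep_bop[OF xs] by (rule image_UN)
    also have "\<dots> \<subseteq> (\<Union>ps\<in>listset (map repA xs). mop N (\<sigma>, map k ps))"
      using k listset_op_dom[OF A.map_rep_op_dom[OF xs]]
      by (intro UN_mono) (auto simp: malg_hom_iff)
    also have "\<dots> = repB (bop B (\<sigma>, map h xs))"
      unfolding B.rep_bop[OF map_h_op_dom[OF xs]] listset_eq by simp
    finally show ?thesis .
  qed
  then show "h \<in> balg_hom S A B"
    using h_PiE h_Sup h_atoms h_bop_le_iff by (auto simp: balg_hom_def)
qed

end

lemma malg_hom_PiE: "h \<in> malg_hom S M N \<Longrightarrow> h \<in> mcarr M \<rightarrow>\<^sub>E mcarr N"
  by (simp add: malg_hom_iff)

lemma balg_hom_PiE: "h \<in> balg_hom S A B \<Longrightarrow> h \<in> bcarr A \<rightarrow>\<^sub>E bcarr B"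
  by (simp add: balg_hom_def)

lemma balg_hom_atoms: "h \<in> balg_hom S A B \<Longrightarrow> h ` atoms A \<subseteq> atoms B"
  by (simp add: balg_hom_def)

lemma malg_hom_id:
  assumes "multialgebra S M"
  shows "(\<lambda>x\<in>mcarr M. x) \<in> malg_hom S M M"
  unfolding malg_hom_iff
proof (intro conjI allI impI)
  fix \<sigma> xs assume xs: "(\<sigma>, xs) \<in> op_dom S (mcarr M)"
  show "(\<lambda>x\<in>mcarr M. x) ` mop M (\<sigma>, xs) \<subseteq> mop M (\<sigma>, map (\<lambda>x\<in>mcarr M. x) xs)"
    using mop_subset[OF assms xs] xs by (auto simp: map_restrict_op_dom)
qed simp

lemma malg_hom_compose:
  assumes M: "multialgebra S M" and f: "f \<in> malg_hom S M N" and g: "g \<in> malg_hom S N P"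
  shows "compose (mcarr M) g f \<in> malg_hom S M P"
  unfolding malg_hom_iff
proof (intro conjI allI impI)
  show "compose (mcarr M) g f \<in> mcarr M \<rightarrow>\<^sub>E mcarr P"
    using malg_hom_PiE[OF f] malg_hom_PiE[OF g] by (auto simp: compose_def)
  fix \<sigma> xs assume xs: "(\<sigma>, xs) \<in> op_dom S (mcarr M)"
  have map_f_op_dom: "(\<sigma>, map f xs) \<in> op_dom S (mcarr N)"
    using malg_hom_PiE[OF f] by (intro op_dom_map[OF xs]) auto
  have "compose (mcarr M) g f ` mop M (\<sigma>, xs) = g ` f ` mop M (\<sigma>, xs)"
    unfolding image_image using mop_subset[OF M xs]
    by (intro image_cong refl) (auto simp: compose_eq)
  also have "\<dots> \<subseteq> g ` mop N (\<sigma>, map f xs)" using f xs by (intro image_mono) (simp add: malg_hom_iff)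
  also have "\<dots> \<subseteq> mop P (\<sigma>, map g (map f xs))" using g map_f_op_dom unfolding malg_hom_iff by blast
  also have "map g (map f xs) = map (compose (mcarr M) g f) xs"
    using xs by (simp add: compose_def map_restrict_op_dom)
  finally show "compose (mcarr M) g f ` mop M (\<sigma>, xs) \<subseteq> mop P (\<sigma>, map (compose (mcarr M) g f) xs)" .
qed

lemma represented_map_compose:
  assumes f: "represented_map S A M repA B N repB f k"
    and g: "represented_map S B N repB C P repC g l"
  shows "represented_map S A M repA C P repC (compose (bcarr A) g f) (compose (mcarr M) l k)"
proof -
  interpret f: represented_map S A M repA B N repB f k by fact
  interpret g: represented_map S B N repB C P repC g l by fact
  show ?thesis
  proof (intro represented_map.intro represented_map_axioms.intro)
    show "compose (bcarr A) g f \<in> bcarr A \<rightarrow>\<^sub>E bcarr C"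
      using f.h_PiE g.h_PiE by (auto simp: compose_def)
    show "compose (mcarr M) l k \<in> mcarr M \<rightarrow>\<^sub>E mcarr P"
      using f.k_PiE g.k_PiE by (auto simp: compose_def)
    fix x assume x: "x \<in> bcarr A"
    then have fx: "f x \<in> bcarr B" using f.h_PiE by auto
    have "repC (compose (bcarr A) g f x) = l ` k ` repA x"
      using x fx by (simp add: compose_eq f.rep_h g.rep_h)
    also have "\<dots> = compose (mcarr M) l k ` repA x"
      unfolding image_image using f.A.rep_subset[of x] x
      by (intro image_cong refl) (auto simp: compose_eq)
    finally show "repC (compose (bcarr A) g f x) = compose (mcarr M) l k ` repA x" .
  qed unfold_locales
qed

lemma represented_map_id:
  assumes "represented_algebra S A M rep"
  shows "represented_map S A M rep A M rep (\<lambda>x\<in>bcarr A. x) (\<lambda>x\<in>mcarr M. x)"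
proof -
  interpret represented_algebra S A M rep by fact
  show ?thesis
  proof unfold_locales
    show "rep ((\<lambda>x\<in>bcarr A. x) x) = (\<lambda>p\<in>mcarr M. p) ` rep x" if "x \<in> bcarr A" for x
      unfolding image_restrict_id_rep[OF that] using that by simp
  qed auto
qed

lemma balg_hom_at_below:
  assumes A: "ordered_algebra S A" and B: "ordered_algebra S B" and h: "h \<in> balg_hom S A B"
    and x: "x \<in> bcarr A"
  shows "at_below B (h x) = h ` at_below A x"
proof -
  interpret A: represented_algebra S A "A_malg S A" "at_below A"
    by (rule represented_algebra_atoms[OF A])
  interpret B: represented_algebra S B "A_malg S B" "at_below B"
    by (rule represented_algebra_atoms[OF B])
  have X: "at_below A x \<subseteq> bcarr A" "at_below A x \<noteq> {}"
    using atoms_below_carrier[of "ord_of A" x] A.rep_nonempty[of x] x by simp_all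
  have hX: "h ` at_below A x \<subseteq> atoms B"
    by (rule subset_trans[OF image_mono[OF atoms_below_subset] balg_hom_atoms[OF h]])
  have "h x = h (\<Squnion>\<^bsub>ord_of A\<^esub>(at_below A x))" using A.Sup_atoms_below x by simp
  also have "\<dots> = \<Squnion>\<^bsub>ord_of B\<^esub>(h ` at_below A x)" using h X by (simp add: balg_hom_def)
  also have "at_below B \<dots> = (\<Union>b\<in>h ` at_below A x. at_below B b)"
    using hX X minimals_subset[of "ord_of B"] by (intro B.rep_Sup) auto
  also have "\<dots> = h ` at_below A x"
    using hX B.atoms_below_minimal by auto
  finally show ?thesis .
qed

lemma represented_map_atoms:
  assumes A: "ordered_algebra S A" and B: "ordered_algebra S B" and h: "h \<in> balg_hom S A B"
  shows "represented_map S A (A_malg S A) (at_below A) B (A_malg S B) (at_below B)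
    h (restrict h (atoms A))"
proof (intro represented_map.intro represented_map_axioms.intro represented_algebra_atoms A B)
  show "h \<in> bcarr A \<rightarrow>\<^sub>E bcarr B" by (rule balg_hom_PiE[OF h])
  show "restrict h (atoms A) \<in> mcarr (A_malg S A) \<rightarrow>\<^sub>E mcarr (A_malg S B)"
    using balg_hom_atoms[OF h] by (auto simp: A_malg_def)
  fix x assume "x \<in> bcarr A"
  then have "at_below B (h x) = h ` at_below A x" by (rule balg_hom_at_below[OF A B h])
  also have "\<dots> = restrict h (atoms A) ` at_below A x"
    using atoms_below_subset[of "ord_of A" x] by (intro image_cong refl) auto
  finally show "at_below B (h x) = restrict h (atoms A) ` at_below A x" .
qed

lemma malg_hom_restrict_atoms:
  assumes "ordered_algebra S A" "ordered_algebra S B" "h \<in> balg_hom S A B"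
  shows "restrict h (atoms A) \<in> malg_hom S (A_malg S A) (A_malg S B)"
  using represented_map.hom_iff[OF represented_map_atoms[OF assms]] assms(3) by simp

lemma balg_hom_id:
  assumes A: "ordered_algebra S A"
  shows "(\<lambda>x\<in>bcarr A. x) \<in> balg_hom S A A"
proof -
  note rep = represented_algebra_atoms[OF A]
  show ?thesis
    unfolding represented_map.hom_iff[OF represented_map_id[OF rep]]
    by (rule malg_hom_id[OF represented_algebra.multialgebra[OF rep]])
qed

lemma balg_hom_compose:
  assumes A: "ordered_algebra S A" and B: "ordered_algebra S B" and C: "ordered_algebra S C"
    and f: "f \<in> balg_hom S A B" and g: "g \<in> balg_hom S B C"
  shows "compose (bcarr A) g f \<in> balg_hom S A C"
proof -
  interpret represented_map S A "A_malg S A" "at_below A" C "A_malg S C" "at_below C"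
    "compose (bcarr A) g f"
    "compose (mcarr (A_malg S A)) (restrict g (atoms B)) (restrict f (atoms A))"
    by (rule represented_map_compose[OF represented_map_atoms[OF A B f]
          represented_map_atoms[OF B C g]])
  show ?thesis
    unfolding hom_iff
    by (rule malg_hom_compose[OF A.multialgebra
          malg_hom_restrict_atoms[OF A B f] malg_hom_restrict_atoms[OF B C g]])
qed

section \<open>Isomorphisms\<close>

lemma restrict_inv_into_PiE: "bij_betw f A B \<Longrightarrow> restrict (inv_into A f) B \<in> B \<rightarrow>\<^sub>E A"
  using bij_betw_apply[OF bij_betw_inv_into] by auto

lemma bij_betw_if_bij_betw_image_Pow_ne:
  assumes "bij_betw ((`) f) (Pow_ne A) (Pow_ne B)"
  shows "bij_betw f A B"
proof (rule bij_betw_imageI)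
  have inj: "inj_on ((`) f) (Pow_ne A)" and surj: "(`) f ` Pow_ne A = Pow_ne B"
    using assms by (simp_all add: bij_betw_def)
  show "inj_on f A"
  proof (rule inj_onI)
    fix a b assume "a \<in> A" "b \<in> A" "f a = f b"
    then show "a = b" using inj_onD[OF inj, of "{a}" "{b}"] by (simp add: Pow_ne_def)
  qed
  have Union_Pow_ne: "\<Union>(Pow_ne C) = C" for C by (auto simp: Pow_ne_def)
  have "f ` A = \<Union>((`) f ` Pow_ne A)"
    by (subst (1) Union_Pow_ne[of A, symmetric]) (rule image_Union)
  then show "f ` A = B" unfolding surj Union_Pow_ne .
qed

lemma representing_malg_unique:
  assumes M: "represented_algebra S B M rep" and N: "represented_algebra S B N rep'"
    and f: "f \<in> mcarr M \<rightarrow>\<^sub>E mcarr N" and rep'_eq: "\<And>x. x \<in> bcarr B \<Longrightarrow> rep' x = f ` rep x"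
  shows "malg_iso S M N f"
proof -
  interpret M: represented_algebra S B M rep by fact
  interpret N: represented_algebra S B N rep' by fact
  let ?g = "restrict (inv_into (mcarr M) f) (mcarr N)"
  have "bij_betw ((`) f \<circ> rep) (bcarr B) (Pow_ne (mcarr N)) \<longleftrightarrow>
      bij_betw rep' (bcarr B) (Pow_ne (mcarr N))"
    by (rule bij_betw_cong) (simp add: rep'_eq)
  then have "bij_betw ((`) f) (Pow_ne (mcarr M)) (Pow_ne (mcarr N))"
    using bij_betw_comp_iff[of rep "bcarr B" "Pow_ne (mcarr M)" "(`) f"] M.bij N.bij by simp
  then have bij: "bij_betw f (mcarr M) (mcarr N)" by (rule bij_betw_if_bij_betw_image_Pow_ne)
  have id_hom: "(\<lambda>x\<in>bcarr B. x) \<in> balg_hom S B B" by (rule balg_hom_id[OF M.ordered_algebra])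
  have g_rep': "?g ` rep' x = rep x" if "x \<in> bcarr B" for x
  proof -
    have "?g ` rep' x = (\<lambda>p. p) ` rep x"
      unfolding rep'_eq[OF that] image_image using M.rep_subset[of x] that f bij
      by (intro image_cong refl) (auto simp: bij_betw_inv_into_left)
    then show ?thesis by simp
  qed
  interpret f: represented_map S B M rep B N rep' "\<lambda>x\<in>bcarr B. x" f
    by unfold_locales (use f rep'_eq in simp_all)
  interpret g: represented_map S B N rep' B M rep "\<lambda>x\<in>bcarr B. x" ?g
    by unfold_locales (use g_rep' restrict_inv_into_PiE[OF bij] in simp_all)
  show ?thesis
    unfolding malg_iso_def
    using f.hom_iff g.hom_iff id_hom compose_inv_into_id[OF bij]
      compose_id_inv_into[of f "mcarr M" "mcarr N"] bij
    by (auto simp: bij_betw_def)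
qed

lemma represented_balg_unique:
  assumes A: "represented_algebra S A M rep" and B: "represented_algebra S B M rep'"
    and f: "f \<in> bcarr A \<rightarrow>\<^sub>E bcarr B" and rep'_f: "\<And>x. x \<in> bcarr A \<Longrightarrow> rep' (f x) = rep x"
  shows "balg_iso S A B f"
proof -
  interpret A: represented_algebra S A M rep by fact
  interpret B: represented_algebra S B M rep' by fact
  let ?g = "restrict (inv_into (bcarr A) f) (bcarr B)"
  have "bij_betw (rep' \<circ> f) (bcarr A) (Pow_ne (mcarr M)) \<longleftrightarrow>
      bij_betw rep (bcarr A) (Pow_ne (mcarr M))"
    by (rule bij_betw_cong) (simp add: rep'_f)
  moreover have "f ` bcarr A \<subseteq> bcarr B" using f by auto
  ultimately have bij: "bij_betw f (bcarr A) (bcarr B)"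
    using bij_betw_comp_iff2[of rep' "bcarr B" "Pow_ne (mcarr M)" f "bcarr A"] A.bij B.bij by simp
  have id_hom: "(\<lambda>x\<in>mcarr M. x) \<in> malg_hom S M M" by (rule malg_hom_id[OF A.multialgebra])
  interpret f: represented_map S A M rep B M rep' f "\<lambda>x\<in>mcarr M. x"
  proof unfold_locales
    show "rep' (f x) = (\<lambda>p\<in>mcarr M. p) ` rep x" if "x \<in> bcarr A" for x
      unfolding A.image_restrict_id_rep[OF that] using that by (rule rep'_f)
  qed (use f in auto)
  interpret g: represented_map S B M rep' A M rep ?g "\<lambda>x\<in>mcarr M. x"
  proof unfold_locales
    fix y assume y: "y \<in> bcarr B"
    then have "?g y \<in> bcarr A" "f (?g y) = y"
      using bij restrict_inv_into_PiE[OF bij] by (auto simp: bij_betw_inv_into_right)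
    then have "rep (?g y) = rep' y" using rep'_f[of "?g y"] by simp
    then show "rep (?g y) = (\<lambda>p\<in>mcarr M. p) ` rep' y"
      unfolding B.image_restrict_id_rep[OF y] .
  qed (use restrict_inv_into_PiE[OF bij] in auto)
  show ?thesis
    unfolding balg_iso_def
    using f.hom_iff g.hom_iff id_hom compose_inv_into_id[OF bij]
      compose_id_inv_into[of f "bcarr A" "bcarr B"] bij
    by (auto simp: bij_betw_def)
qed

section \<open>The functors\<close>

lemma MAlg_simps [simp]:
  "Obj (MAlg S) = {M. multialgebra S M}"
  "Hom (MAlg S) = malg_hom S"
  "Ident (MAlg S) M = (\<lambda>x\<in>mcarr M. x)"
  "Comp (MAlg S) M N P g f = compose (mcarr M) g f"
  by (simp_all add: MAlg_def)

lemma AlgB_simps [simp]: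
  "Obj (AlgB S) = {B. ordered_algebra S B}"
  "Hom (AlgB S) = balg_hom S"
  "Ident (AlgB S) B = (\<lambda>x\<in>bcarr B. x)"
  "Comp (AlgB S) A B C g f = compose (bcarr A) g f"
  by (simp_all add: AlgB_def)

lemma full_subcategory_simps [simp]:
  "Obj (full_subcategory C X) = Obj C \<inter> X"
  "Hom (full_subcategory C X) = Hom C"
  "Ident (full_subcategory C X) = Ident C"
  "Comp (full_subcategory C X) = Comp C"
  by (simp_all add: full_subcategory_def)

lemma full_subcategory_UNIV [simp]: "full_subcategory C UNIV = C"
  by (simp add: full_subcategory_def)

lemma comp_ftor_simps [simp]:
  "fobj (G \<circ>\<^sub>F F) X = fobj G (fobj F X)"
  "farr (G \<circ>\<^sub>F F) X Y f = farr G (fobj F X) (fobj F Y) (farr F X Y f)"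
  by (simp_all add: comp_ftor_def)

lemma A_ftor_simps [simp]:
  "fobj (A_ftor S) = A_malg S"
  "farr (A_ftor S) A B h = restrict h (atoms A)"
  by (simp_all add: A_ftor_def)

lemma mcarr_A_malg [simp]: "mcarr (A_malg S B) = atoms B"
  by (simp add: A_malg_def)

lemma category_if_concrete:
  fixes C :: "('o, 'a \<Rightarrow> 'a) cat" and U :: "'o \<Rightarrow> 'a set"
  assumes Ident: "\<And>X. Ident C X = (\<lambda>x\<in>U X. x)"
    and Comp: "\<And>X Y Z g f. Comp C X Y Z g f = compose (U X) g f"
    and Hom_PiE: "\<And>X Y f. f \<in> Hom C X Y \<Longrightarrow> f \<in> U X \<rightarrow>\<^sub>E U Y"
    and Ident_closed: "\<And>X. X \<in> Obj C \<Longrightarrow> (\<lambda>x\<in>U X. x) \<in> Hom C X X"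
    and Comp_closed: "\<And>X Y Z f g. \<lbrakk>X \<in> Obj C; Y \<in> Obj C; Z \<in> Obj C; f \<in> Hom C X Y; g \<in> Hom C Y Z\<rbrakk>
      \<Longrightarrow> compose (U X) g f \<in> Hom C X Z"
  shows "category C"
proof -
  have Hom: "f \<in> U X \<rightarrow> U Y" "f \<in> extensional (U X)" if "f \<in> Hom C X Y" for X Y f
    using Hom_PiE[OF that] by (simp_all add: PiE_def)
  show ?thesis
    unfolding category_def Ident Comp
    by (intro conjI ballI)
      (rule Ident_closed Comp_closed compose_Id[OF Hom] Id_compose[OF Hom]
        compose_assoc[OF Hom(1), symmetric]; assumption)+
qed

lemma category_MAlg: "category (MAlg S)"
  by (rule category_if_concrete[where U = mcarr])
    (auto intro: malg_hom_id malg_hom_compose dest: malg_hom_PiE)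

lemma category_AlgB: "category (AlgB S)"
  by (rule category_if_concrete[where U = bcarr])
    (auto intro: balg_hom_id balg_hom_compose dest: balg_hom_PiE)

lemma category_full_subcategory: "category C \<Longrightarrow> category (full_subcategory C X)"
  by (auto simp: category_def)

lemma is_functor_full_subcategory:
  assumes "is_functor C D F" "\<And>X. X \<in> Obj C \<Longrightarrow> X \<in> A \<Longrightarrow> fobj F X \<in> B"
  shows "is_functor (full_subcategory C A) (full_subcategory D B) F"
  using assms category_full_subcategory[of C A] category_full_subcategory[of D B]
  unfolding is_functor_def by auto

lemma is_functor_comp: "is_functor C D F \<Longrightarrow> is_functor D E G \<Longrightarrow> is_functor C E (G \<circ>\<^sub>F F)"
  unfolding is_functor_def by simp

lemma naturally_isomorphic_idI:
  assumes F: "is_functor C C F"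
    and iso: "\<And>X. X \<in> Obj C \<Longrightarrow> iso_in C X (fobj F X) (\<eta> X)"
    and natural: "\<And>X Y f. \<lbrakk>X \<in> Obj C; Y \<in> Obj C; f \<in> Hom C X Y\<rbrakk> \<Longrightarrow>
      Comp C X Y (fobj F Y) (\<eta> Y) f = Comp C X (fobj F X) (fobj F Y) (farr F X Y f) (\<eta> X)"
  shows "naturally_isomorphic C C id_ftor F"
proof -
  have "is_functor C C id_ftor" using F by (simp add: is_functor_def id_ftor_def)
  then show ?thesis
    unfolding naturally_isomorphic_def using F iso natural
    by (intro conjI exI[of _ \<eta>]) (simp_all add: id_ftor_def)
qed

theorem is_functor_A_ftor:
  fixes S :: "nat \<Rightarrow> 's set"
  shows "is_functor (AlgB S) (MAlg S)
    (A_ftor S :: (('s, 'b) balg, 'b \<Rightarrow> 'b, ('s, 'b) malg, 'b \<Rightarrow> 'b) ftor)"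
  unfolding is_functor_def
proof (intro conjI ballI category_MAlg category_AlgB)
  fix A :: "('s, 'b) balg" assume A: "A \<in> Obj (AlgB S)"
  show "fobj (A_ftor S) A \<in> Obj (MAlg S)"
    using represented_algebra.multialgebra[OF represented_algebra_atoms] A by simp
  show "farr (A_ftor S) A A (Ident (AlgB S) A) = Ident (MAlg S) (fobj (A_ftor S) A)"
    using minimals_subset[of "ord_of A"] by (auto simp: fun_eq_iff)
next
  fix A B :: "('s, 'b) balg" and h
  assume "A \<in> Obj (AlgB S)" "B \<in> Obj (AlgB S)" "h \<in> Hom (AlgB S) A B"
  then show "farr (A_ftor S) A B h \<in> Hom (MAlg S) (fobj (A_ftor S) A) (fobj (A_ftor S) B)"
    by (simp add: malg_hom_restrict_atoms)
next
  fix A B C :: "('s, 'b) balg" and f g :: "'b \<Rightarrow> 'b"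
  assume "f \<in> Hom (AlgB S) A B"
  then have "f x \<in> atoms B" if "x \<in> atoms A" for x using that balg_hom_atoms[of f S A B] by auto
  then show "farr (A_ftor S) A C (Comp (AlgB S) A B C g f) =
      Comp (MAlg S) (fobj (A_ftor S) A) (fobj (A_ftor S) B) (fobj (A_ftor S) C)
        (farr (A_ftor S) B C g) (farr (A_ftor S) A B f)"
    using minimals_subset[of "ord_of A"] by (auto simp: fun_eq_iff compose_def)
qed

subsection \<open>Relabelled powersets\<close>

abbreviation relabelled_P_alg ::
  "('a set \<Rightarrow> 'b) \<Rightarrow> (nat \<Rightarrow> 's set) \<Rightarrow> ('s, 'a) malg \<Rightarrow> ('s, 'b) balg" where
  "relabelled_P_alg c S M \<equiv> relabel_balg c S (P_alg S M)"

definition relabelled_P_ftor ::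
  "('a set \<Rightarrow> 'b) \<Rightarrow> (nat \<Rightarrow> 's set) \<Rightarrow> (('s, 'a) malg, 'a \<Rightarrow> 'a, ('s, 'b) balg, 'b \<Rightarrow> 'b) ftor" where
  "relabelled_P_ftor c S = relabel_ftor c S \<circ>\<^sub>F P_ftor S"

abbreviation unlabel :: "('a set \<Rightarrow> 'b) \<Rightarrow> ('s, 'a) malg \<Rightarrow> 'b \<Rightarrow> 'a set" where
  "unlabel c M \<equiv> inv_into (Pow_ne (mcarr M)) c"

lemma bcarr_relabelled_P_alg [simp]: "bcarr (relabelled_P_alg c S M) = c ` Pow_ne (mcarr M)"
  by (simp add: relabel_balg_def P_alg_def)

lemma map_inv_into_op_dom:
  "(\<sigma>, ys) \<in> op_dom S (c ` A) \<Longrightarrow> (\<sigma>, map (inv_into A c) ys) \<in> op_dom S A"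
  by (erule op_dom_map) (auto intro: inv_into_into)

lemma Union_mop_in_Pow_ne:
  assumes M: "multialgebra S M" and Xs: "(\<sigma>, Xs) \<in> op_dom S (Pow_ne (mcarr M))"
  shows "(\<Union>xs\<in>listset Xs. mop M (\<sigma>, xs)) \<in> Pow_ne (mcarr M)"
proof -
  have "mop M (\<sigma>, xs) \<in> Pow_ne (mcarr M)" if "xs \<in> listset Xs" for xs
    by (rule mop_in_Pow_ne[OF M listset_op_dom[OF Xs that]])
  then show ?thesis using listset_op_dom_nonempty[OF Xs] by (fastforce simp: Pow_ne_def)
qed

lemma bop_relabelled_P_alg:
  assumes "(\<sigma>, ys) \<in> op_dom S (c ` Pow_ne (mcarr M))"
  shows "bop (relabelled_P_alg c S M) (\<sigma>, ys) =
    c (\<Union>xs\<in>listset (map (unlabel c M) ys). mop M (\<sigma>, xs))"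
  using assms map_inv_into_op_dom[OF assms]
  by (simp add: relabel_balg_def P_alg_def Setcompr_eq_image)

lemma fobj_relabelled_P_ftor [simp]: "fobj (relabelled_P_ftor c S) M = relabelled_P_alg c S M"
  by (simp add: relabelled_P_ftor_def relabel_ftor_def P_ftor_def)

lemma farr_relabelled_P_ftor [simp]:
  "farr (relabelled_P_ftor c S) M N h = (\<lambda>y\<in>c ` Pow_ne (mcarr M). c (h ` unlabel c M y))"
proof -
  have "unlabel c M y \<in> Pow_ne (mcarr M)" if "y \<in> c ` Pow_ne (mcarr M)" for y
    using that by (rule inv_into_into)
  then show ?thesis
    by (auto simp: relabelled_P_ftor_def relabel_ftor_def P_ftor_def P_alg_def intro!: restrict_ext)
qed

lemma relabel_balg_id:
  assumes "bop B \<in> extensional (op_dom S (bcarr B))"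
  shows "relabel_balg id S B = B"
proof -
  have "bop (relabel_balg id S B) p = bop B p" for p
  proof (cases "p \<in> op_dom S (bcarr B)")
    case True
    obtain \<sigma> xs where p: "p = (\<sigma>, xs)" by (cases p)
    have "map (inv_into (bcarr B) id) xs = xs"
      using True inv_into_f_f[of id "bcarr B"]
      by (auto simp: p op_dom_iff subset_iff intro!: map_idI)
    then show ?thesis using True by (simp add: relabel_balg_def p)
  next
    case False
    then show ?thesis using extensional_arb[OF assms] by (simp add: relabel_balg_def)
  qed
  then show ?thesis by (intro balg.equality) (auto simp: relabel_balg_def fun_eq_iff map_prod.id)
qed

lemma relabelled_P_ftor_id:
  fixes S :: "nat \<Rightarrow> 's set"
  shows "relabelled_P_ftor id S =
    (P_ftor S :: (('s, 'a) malg, 'a \<Rightarrow> 'a, ('s, 'a set) balg, 'a set \<Rightarrow> 'a set) ftor)"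
proof -
  have "bop (P_alg S M) \<in> extensional (op_dom S (bcarr (P_alg S M)))" for M :: "('s, 'a) malg"
    by (simp add: P_alg_def)
  then have "fobj (relabelled_P_ftor id S) M = fobj (P_ftor S) M" for M :: "('s, 'a) malg"
    by (simp add: P_ftor_def relabel_balg_id)
  moreover have "inv_into (Pow_ne A) id X = X" if "X \<in> Pow_ne A" for A X :: "'a set"
    using inv_into_f_f[of id "Pow_ne A"] that by simp
  then have "farr (relabelled_P_ftor id S) M N h = farr (P_ftor S) M N h"
    for M N :: "('s, 'a) malg" and h
    by (auto simp: fun_eq_iff P_ftor_def)
  ultimately show ?thesis by (intro ftor.equality) (simp_all add: fun_eq_iff)
qed

lemma represented_algebra_relabelled_P_alg:
  assumes M: "multialgebra S M" and inj: "inj_on c (Pow_ne (mcarr M))"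
  shows "represented_algebra S (relabelled_P_alg c S M) M (unlabel c M)"
proof (rule represented_algebra.intro)
  let ?B = "relabelled_P_alg c S M"
  note Union = Union_mop_in_Pow_ne[OF M map_inv_into_op_dom]
  show "bop ?B \<in> op_dom S (bcarr ?B) \<rightarrow>\<^sub>E bcarr ?B"
  proof (rule PiE_I)
    show "bop ?B p \<in> bcarr ?B" if "p \<in> op_dom S (bcarr ?B)" for p
      using that by (cases p) (auto simp: bop_relabelled_P_alg intro!: imageI Union)
  qed (simp add: relabel_balg_def P_alg_def)
  show "ble ?B \<subseteq> bcarr ?B \<times> bcarr ?B" by (auto simp: relabel_balg_def P_alg_def)
  show "unlabel c M (bop ?B (\<sigma>, ys)) = (\<Union>xs\<in>listset (map (unlabel c M) ys). mop M (\<sigma>, xs))"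
    if "(\<sigma>, ys) \<in> op_dom S (bcarr ?B)" for \<sigma> ys
    using that by (simp add: bop_relabelled_P_alg inv_into_f_f[OF inj Union])
  show "nonempty_powerset_representation (ord_of ?B) (unlabel c M) (mcarr M)"
  proof unfold_locales
    show "bij_betw (unlabel c M) (carrier (ord_of ?B)) (Pow_ne (mcarr M))"
      using inj by (simp add: bij_betw_inv_into inj_on_imp_bij_betw)
    show "y \<sqsubseteq>\<^bsub>ord_of ?B\<^esub> z \<longleftrightarrow> unlabel c M y \<subseteq> unlabel c M z"
      if y: "y \<in> carrier (ord_of ?B)" and z: "z \<in> carrier (ord_of ?B)" for y z
    proof -
      obtain Y where Y: "Y \<in> Pow_ne (mcarr M)" "y = c Y" using y by auto
      obtain Z where Z: "Z \<in> Pow_ne (mcarr M)" "z = c Z" using z by auto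
      have "(c Y, c Z) \<in> ble ?B \<longleftrightarrow> Y \<subseteq> Z"
        using Y(1) Z(1) inj by (auto simp: relabel_balg_def P_alg_def inj_on_eq_iff)
      then show ?thesis using Y Z by (simp add: inv_into_f_f[OF inj])
    qed
    show "mcarr M \<noteq> {}" using M by (simp add: multialgebra_def)
  qed simp
qed (rule M)

lemma represented_map_relabelled_P_ftor:
  assumes M: "multialgebra S M" and N: "multialgebra S N" and h: "h \<in> mcarr M \<rightarrow>\<^sub>E mcarr N"
    and injM: "inj_on c (Pow_ne (mcarr M))" and injN: "inj_on c (Pow_ne (mcarr N))"
  shows "represented_map S (relabelled_P_alg c S M) M (unlabel c M)
    (relabelled_P_alg c S N) N (unlabel c N) (farr (relabelled_P_ftor c S) M N h) h"
proof (intro represented_map.intro represented_map_axioms.intro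
    represented_algebra_relabelled_P_alg M N injM injN h)
  have image: "h ` unlabel c M y \<in> Pow_ne (mcarr N)" if "y \<in> c ` Pow_ne (mcarr M)" for y
    using inv_into_into[OF that] h by (auto simp: Pow_ne_def)
  then show "farr (relabelled_P_ftor c S) M N h \<in>
      bcarr (relabelled_P_alg c S M) \<rightarrow>\<^sub>E bcarr (relabelled_P_alg c S N)"
    by auto
  show "unlabel c N (farr (relabelled_P_ftor c S) M N h y) = h ` unlabel c M y"
    if "y \<in> bcarr (relabelled_P_alg c S M)" for y
    using that image inv_into_f_f[OF injN] by simp
qed

theorem is_functor_relabelled_P_ftor:
  fixes S :: "nat \<Rightarrow> 's set" and c :: "'a set \<Rightarrow> 'b"
  assumes inj: "\<And>M :: ('s, 'a) malg. M \<in> \<M> \<Longrightarrow> inj_on c (Pow_ne (mcarr M))"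
    and closed: "\<And>M. multialgebra S M \<Longrightarrow> M \<in> \<M> \<Longrightarrow> relabelled_P_alg c S M \<in> \<B>"
  shows "is_functor (full_subcategory (MAlg S) \<M>) (full_subcategory (AlgB S) \<B>)
    (relabelled_P_ftor c S)" (is "is_functor ?C ?D ?F")
  unfolding is_functor_def
proof (intro conjI ballI category_full_subcategory category_MAlg category_AlgB)
  fix M :: "('s, 'a) malg" assume "M \<in> Obj ?C"
  then have M: "multialgebra S M" "M \<in> \<M>" by simp_all
  interpret represented_algebra S "relabelled_P_alg c S M" M "unlabel c M"
    by (rule represented_algebra_relabelled_P_alg[OF M(1) inj[OF M(2)]])
  show "fobj ?F M \<in> Obj ?D" using ordered_algebra closed[OF M] by simp
  have "c ((\<lambda>a\<in>mcarr M. a) ` unlabel c M y) = y" if "y \<in> c ` Pow_ne (mcarr M)" for y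
    using image_restrict_id_rep[of y] f_inv_into_f[OF that] that
    by (simp only: bcarr_relabelled_P_alg)
  then show "farr ?F M M (Ident ?C M) = Ident ?D (fobj ?F M)" by (auto simp: fun_eq_iff)
next
  fix M N :: "('s, 'a) malg" and h
  assume "M \<in> Obj ?C" "N \<in> Obj ?C" "h \<in> Hom ?C M N"
  then show "farr ?F M N h \<in> Hom ?D (fobj ?F M) (fobj ?F N)"
    using represented_map.hom_iff[OF represented_map_relabelled_P_ftor[OF _ _ malg_hom_PiE inj inj],
        of S M N h] by simp
next
  fix M N P :: "('s, 'a) malg" and f g :: "'a \<Rightarrow> 'a"
  assume N: "N \<in> Obj ?C" and f: "f \<in> Hom ?C M N"
  have "f \<in> mcarr M \<rightarrow> mcarr N" using f malg_hom_PiE[of f S M N] by auto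
  then have "f ` X \<in> Pow_ne (mcarr N)" "compose (mcarr M) g f ` X = g ` f ` X"
    if "X \<in> Pow_ne (mcarr M)" for X
    using that by (auto simp: Pow_ne_def compose_def image_image)
  then show "farr ?F M P (Comp ?C M N P g f) =
      Comp ?D (fobj ?F M) (fobj ?F N) (fobj ?F P) (farr ?F N P g) (farr ?F M N f)"
    using inv_into_into[of _ c "Pow_ne (mcarr M)"] inv_into_f_f[OF inj, of N] N
    by (auto simp: fun_eq_iff compose_def)
qed

section \<open>The equivalence\<close>

lemma
  assumes M: "multialgebra S M" and inj: "inj_on c (Pow_ne (mcarr M))"
  shows atoms_relabelled_P_alg: "atoms (relabelled_P_alg c S M) = (\<lambda>a. c {a}) ` mcarr M"
    and at_below_relabelled_P_alg: "y \<in> c ` Pow_ne (mcarr M) \<Longrightarrow>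
      at_below (relabelled_P_alg c S M) y = (\<lambda>a. c {a}) ` unlabel c M y"
proof -
  interpret represented_algebra S "relabelled_P_alg c S M" M "unlabel c M"
    by (rule represented_algebra_relabelled_P_alg[OF M inj])
  have atom: "atom a = c {a}" if "a \<in> mcarr M" for a
  proof -
    have "{a} \<in> Pow_ne (mcarr M)" using that by (simp add: Pow_ne_def)
    then show ?thesis
      using rep_eq_iff[of "atom a" "c {a}"] atom_in_carrier[OF that] rep_atom[OF that]
      by (simp add: inv_into_f_f[OF inj])
  qed
  show "atoms (relabelled_P_alg c S M) = (\<lambda>a. c {a}) ` mcarr M"
    unfolding minimals_eq by (intro image_cong HOL.refl atom)
  show "at_below (relabelled_P_alg c S M) y = (\<lambda>a. c {a}) ` unlabel c M y"
    if "y \<in> c ` Pow_ne (mcarr M)"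
    using atoms_below_eq[of y] rep_subset[of y] that atom by (auto intro!: image_cong)
qed

lemma malg_iso_singleton:
  assumes M: "multialgebra S M" and inj: "inj_on c (Pow_ne (mcarr M))"
  shows "malg_iso S M (A_malg S (relabelled_P_alg c S M)) (\<lambda>a\<in>mcarr M. c {a})"
proof (rule representing_malg_unique)
  let ?B = "relabelled_P_alg c S M"
  show "represented_algebra S ?B M (unlabel c M)"
    by (rule represented_algebra_relabelled_P_alg[OF M inj])
  then show "represented_algebra S ?B (A_malg S ?B) (at_below ?B)"
    by (intro represented_algebra_atoms represented_algebra.ordered_algebra)
  show "(\<lambda>a\<in>mcarr M. c {a}) \<in> mcarr M \<rightarrow>\<^sub>E mcarr (A_malg S ?B)"
    by (simp add: atoms_relabelled_P_alg[OF M inj])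
  show "at_below ?B y = (\<lambda>a\<in>mcarr M. c {a}) ` unlabel c M y" if "y \<in> bcarr ?B" for y
  proof -
    have y: "y \<in> c ` Pow_ne (mcarr M)" using that by simp
    have "unlabel c M y \<subseteq> mcarr M"
      using inv_into_into[OF y] by (simp add: Pow_ne_def)
    then show ?thesis
      unfolding at_below_relabelled_P_alg[OF M inj y] by (intro image_cong refl) auto
  qed
qed

lemma singleton_natural:
  assumes M: "multialgebra S M" and inj: "inj_on c (Pow_ne (mcarr M))" and h: "h \<in> malg_hom S M N"
  shows "compose (mcarr M) (\<lambda>a\<in>mcarr N. c {a}) h =
    compose (mcarr M) (farr (A_ftor S \<circ>\<^sub>F relabelled_P_ftor c S) M N h) (\<lambda>a\<in>mcarr M. c {a})"
proof -
  have "{a} \<in> Pow_ne (mcarr M)" "h a \<in> mcarr N" if "a \<in> mcarr M" for a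
    using that malg_hom_PiE[OF h] by (auto simp: Pow_ne_def)
  then show ?thesis
    by (auto simp: fun_eq_iff compose_def atoms_relabelled_P_alg[OF M inj] inv_into_f_f[OF inj])
qed

lemma balg_iso_at_below:
  assumes B: "ordered_algebra S B" and inj: "inj_on c (Pow_ne (atoms B))"
  shows "balg_iso S B (relabelled_P_alg c S (A_malg S B)) (\<lambda>x\<in>bcarr B. c (at_below B x))"
proof (rule represented_balg_unique)
  show rep: "represented_algebra S B (A_malg S B) (at_below B)"
    by (rule represented_algebra_atoms[OF B])
  interpret represented_algebra S B "A_malg S B" "at_below B" by (rule rep)
  show "represented_algebra S (relabelled_P_alg c S (A_malg S B)) (A_malg S B)
      (unlabel c (A_malg S B))"
    using inj by (intro represented_algebra_relabelled_P_alg multialgebra) simp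
  show "(\<lambda>x\<in>bcarr B. c (at_below B x)) \<in> bcarr B \<rightarrow>\<^sub>E bcarr (relabelled_P_alg c S (A_malg S B))"
    using rep_closed by auto
  show "unlabel c (A_malg S B) ((\<lambda>x\<in>bcarr B. c (at_below B x)) x) = at_below B x"
    if "x \<in> bcarr B" for x
    using that rep_closed[of x] inv_into_f_f[OF inj] by simp
qed

lemma at_below_natural:
  assumes A: "ordered_algebra S A" and inj: "inj_on c (Pow_ne (atoms A))"
    and B: "ordered_algebra S B" and h: "h \<in> balg_hom S A B"
  shows "compose (bcarr A) (\<lambda>x\<in>bcarr B. c (at_below B x)) h =
    compose (bcarr A) (farr (relabelled_P_ftor c S \<circ>\<^sub>F A_ftor S) A B h)
      (\<lambda>x\<in>bcarr A. c (at_below A x))"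
proof -
  interpret represented_map S A "A_malg S A" "at_below A" B "A_malg S B" "at_below B"
    h "restrict h (atoms A)"
    by (rule represented_map_atoms[OF A B h])
  have "h x \<in> bcarr B" "at_below A x \<in> Pow_ne (atoms A)"
    "at_below B (h x) = restrict h (atoms A) ` at_below A x" if "x \<in> bcarr A" for x
    using that h_PiE A.rep_closed[of x] rep_h by auto
  then show ?thesis
    using inv_into_f_f[OF inj] by (auto simp: fun_eq_iff compose_def)
qed

lemma small_universe_inj_on:
  assumes "small_universe small code" "small A"
  shows "inj_on code (Pow_ne A)"
proof (rule inj_on_subset)
  show "inj_on code {X. small X}" using assms by (simp add: small_universe_def)
  show "Pow_ne A \<subseteq> {X. small X}"
    using assms subset_imp_lepoll[of _ A] unfolding small_universe_def Pow_ne_def by blast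
qed

lemma small_universe_image: "small_universe small code \<Longrightarrow> small A \<Longrightarrow> small (f ` A)"
  using image_lepoll by (auto simp: small_universe_def)

lemma coded_P_ftor_eq: "coded_P_ftor code S = relabelled_P_ftor code S"
  by (simp add: coded_P_ftor_def relabelled_P_ftor_def)

theorem is_functor_P_ftor:
  fixes S :: "nat \<Rightarrow> 's set"
  shows "is_functor (MAlg S) (AlgB S)
    (P_ftor S :: (('s, 'a) malg, 'a \<Rightarrow> 'a, ('s, 'a set) balg, 'a set \<Rightarrow> 'a set) ftor)"
  using is_functor_relabelled_P_ftor[of UNIV id S UNIV] by (simp add: relabelled_P_ftor_id)

theorem malg_naturally_iso_to_id_A_P:
  fixes S :: "nat \<Rightarrow> 's set"
  shows "malg_naturally_iso_to_id S
    (A_ftor S \<circ>\<^sub>F P_ftor S :: (('s, 'a) malg, 'a \<Rightarrow> 'a, ('s, 'a set) malg, 'a set \<Rightarrow> 'a set) ftor)"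
  unfolding malg_naturally_iso_to_id_def relabelled_P_ftor_id[symmetric]
proof (intro exI[of _ "\<lambda>M. \<lambda>a\<in>mcarr M. id {a}"] conjI ballI)
  fix M N :: "('s, 'a) malg" and h assume "M \<in> Obj (MAlg S)" "h \<in> malg_hom S M N"
  then show "compose (mcarr M) (\<lambda>a\<in>mcarr N. id {a}) h =
      compose (mcarr M) (farr (A_ftor S \<circ>\<^sub>F relabelled_P_ftor id S) M N h) (\<lambda>a\<in>mcarr M. id {a})"
    by (intro singleton_natural) simp_all
qed (simp add: malg_iso_singleton del: id_apply)

theorem balg_naturally_iso_to_id_P_A:
  fixes S :: "nat \<Rightarrow> 's set"
  shows "balg_naturally_iso_to_id S
    (P_ftor S \<circ>\<^sub>F A_ftor S :: (('s, 'b) balg, 'b \<Rightarrow> 'b, ('s, 'b set) balg, 'b set \<Rightarrow> 'b set) ftor)"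
  unfolding balg_naturally_iso_to_id_def relabelled_P_ftor_id[symmetric]
proof (intro exI[of _ "\<lambda>B. \<lambda>x\<in>bcarr B. id (at_below B x)"] conjI ballI)
  fix A B :: "('s, 'b) balg" and h assume "A \<in> Obj (AlgB S)" "B \<in> Obj (AlgB S)" "h \<in> balg_hom S A B"
  then show "compose (bcarr A) (\<lambda>x\<in>bcarr B. id (at_below B x)) h =
      compose (bcarr A) (farr (relabelled_P_ftor id S \<circ>\<^sub>F A_ftor S) A B h)
        (\<lambda>x\<in>bcarr A. id (at_below A x))"
    by (intro at_below_natural) simp_all
qed (simp add: balg_iso_at_below del: id_apply)

lemma is_functor_small_A_ftor: "is_functor (small_AlgB small S) (small_MAlg small S) (A_ftor S)"
  unfolding small_AlgB_def small_MAlg_def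
  by (rule is_functor_full_subcategory[OF is_functor_A_ftor]) simp

lemma is_functor_coded_P_ftor:
  fixes S :: "nat \<Rightarrow> 's set" and code :: "'u set \<Rightarrow> 'u"
  assumes universe: "small_universe small code"
  shows "is_functor (small_MAlg small S) (small_AlgB small S) (coded_P_ftor code S)"
  unfolding small_MAlg_def small_AlgB_def coded_P_ftor_eq
proof (rule is_functor_relabelled_P_ftor)
  show "inj_on code (Pow_ne (mcarr M))" if "M \<in> {M. small (mcarr M)}" for M :: "('s, 'u) malg"
    using small_universe_inj_on[OF universe] that by simp
  then show "relabelled_P_alg code S M \<in> {B. small (atoms B)}"
    if "multialgebra S M" "M \<in> {M. small (mcarr M)}" for M :: "('s, 'u) malg"
    using small_universe_image[OF universe] that by (simp add: atoms_relabelled_P_alg)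
qed

lemma naturally_isomorphic_id_A_coded_P:
  fixes S :: "nat \<Rightarrow> 's set" and code :: "'u set \<Rightarrow> 'u"
  assumes universe: "small_universe small code"
  shows "naturally_isomorphic (small_MAlg small S) (small_MAlg small S) id_ftor
    (A_ftor S \<circ>\<^sub>F coded_P_ftor code S)" (is "naturally_isomorphic ?C _ _ ?F")
proof (rule naturally_isomorphic_idI)
  show "is_functor ?C ?C ?F"
    by (rule is_functor_comp[OF is_functor_coded_P_ftor[OF universe] is_functor_small_A_ftor])
next
  fix M :: "('s, 'u) malg" assume "M \<in> Obj ?C"
  then have "malg_iso S M (A_malg S (relabelled_P_alg code S M)) (\<lambda>a\<in>mcarr M. code {a})"
    using small_universe_inj_on[OF universe]
    by (intro malg_iso_singleton) (simp_all add: small_MAlg_def)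
  then show "iso_in ?C M (fobj ?F M) (\<lambda>a\<in>mcarr M. code {a})"
    by (simp add: malg_iso_def iso_in_def small_MAlg_def coded_P_ftor_eq)
next
  fix M N :: "('s, 'u) malg" and h
  assume "M \<in> Obj ?C" "h \<in> Hom ?C M N"
  then have "multialgebra S M" "inj_on code (Pow_ne (mcarr M))" "h \<in> malg_hom S M N"
    using small_universe_inj_on[OF universe] by (simp_all add: small_MAlg_def)
  from singleton_natural[OF this]
  show "Comp ?C M N (fobj ?F N) (\<lambda>a\<in>mcarr N. code {a}) h =
      Comp ?C M (fobj ?F M) (fobj ?F N) (farr ?F M N h) (\<lambda>a\<in>mcarr M. code {a})"
    unfolding coded_P_ftor_eq small_MAlg_def full_subcategory_simps MAlg_simps .
qed

lemma naturally_isomorphic_id_coded_P_A: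
  fixes S :: "nat \<Rightarrow> 's set" and code :: "'u set \<Rightarrow> 'u"
  assumes universe: "small_universe small code"
  shows "naturally_isomorphic (small_AlgB small S) (small_AlgB small S) id_ftor
    (coded_P_ftor code S \<circ>\<^sub>F A_ftor S)" (is "naturally_isomorphic ?C _ _ ?F")
proof (rule naturally_isomorphic_idI)
  show "is_functor ?C ?C ?F"
    by (rule is_functor_comp[OF is_functor_small_A_ftor is_functor_coded_P_ftor[OF universe]])
next
  fix B :: "('s, 'u) balg" assume "B \<in> Obj ?C"
  then have "balg_iso S B (relabelled_P_alg code S (A_malg S B))
      (\<lambda>x\<in>bcarr B. code (at_below B x))"
    using small_universe_inj_on[OF universe]
    by (intro balg_iso_at_below) (simp_all add: small_AlgB_def)
  then show "iso_in ?C B (fobj ?F B) (\<lambda>x\<in>bcarr B. code (at_below B x))"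
    by (simp add: balg_iso_def iso_in_def small_AlgB_def coded_P_ftor_eq)
next
  fix A B :: "('s, 'u) balg" and h
  assume "A \<in> Obj ?C" "B \<in> Obj ?C" "h \<in> Hom ?C A B"
  then have "ordered_algebra S A" "inj_on code (Pow_ne (atoms A))"
    "ordered_algebra S B" "h \<in> balg_hom S A B"
    using small_universe_inj_on[OF universe] by (simp_all add: small_AlgB_def)
  from at_below_natural[OF this]
  show "Comp ?C A B (fobj ?F B) (\<lambda>x\<in>bcarr B. code (at_below B x)) h =
      Comp ?C A (fobj ?F A) (fobj ?F B) (farr ?F A B h) (\<lambda>x\<in>bcarr A. code (at_below A x))"
    unfolding coded_P_ftor_eq small_AlgB_def full_subcategory_simps AlgB_simps .
qed

theorem mainTheorem1:
  fixes S :: "nat \<Rightarrow> 's set"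
  assumes "signature S"
  shows
    "is_functor (MAlg S) (AlgB S)
        (P_ftor S :: (('s, 'a) malg, 'a \<Rightarrow> 'a, ('s, 'a set) balg, 'a set \<Rightarrow> 'a set) ftor) \<and>
     is_functor (AlgB S) (MAlg S)
        (A_ftor S :: (('s, 'b) balg, 'b \<Rightarrow> 'b, ('s, 'b) malg, 'b \<Rightarrow> 'b) ftor) \<and>
     malg_naturally_iso_to_id S
        (A_ftor S \<circ>\<^sub>F P_ftor S :: (('s, 'a) malg, 'a \<Rightarrow> 'a, ('s, 'a set) malg, 'a set \<Rightarrow> 'a set) ftor) \<and>
     balg_naturally_iso_to_id S
        (P_ftor S \<circ>\<^sub>F A_ftor S :: (('s, 'b) balg, 'b \<Rightarrow> 'b, ('s, 'b set) balg, 'b set \<Rightarrow> 'b set) ftor) \<and>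
     (\<forall>(small :: 'u set \<Rightarrow> bool) code. small_universe small code \<longrightarrow>
        equivalence_of_categories (small_MAlg small S) (small_AlgB small S)
          (coded_P_ftor code S) (A_ftor S))"
  unfolding equivalence_of_categories_def
  by (intro conjI allI impI is_functor_P_ftor is_functor_A_ftor malg_naturally_iso_to_id_A_P
      balg_naturally_iso_to_id_P_A is_functor_coded_P_ftor is_functor_small_A_ftor
      naturally_isomorphic_id_A_coded_P naturally_isomorphic_id_coded_P_A)

end
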